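(* Let $X$ be a real Banach space and let $g:X^*\to(-\infty,+\infty]$ be a proper convex weak$^*$-lower semicontinuous function such that $\operatorname{int}(\operatorname{dom} g)\ne\emptyset$ (respectively, $\operatorname{int}(\operatorname{dom}(g^*|_X))\neq\emptyset$). Then for any $x_0^*\in D(\partial g\cap X)$ and any $x^*\in\operatorname{dom} g$ (respectively, any $x^*\in X^*$), $$g(x^* )=g(x_0^* )+\sup\Big\{\sum_{i=0}^{n-1}\langle x_i,x_{i+1}^*-x_i^*\rangle+\langle x_n,x^*-x_n^*\rangle\Big\},$$ where the supremum is taken over all integers $n\ge0$, all $x_1^*,\dots,x_n^*\in X^*$ and all $x_i\in\partial g(x_i^* )\cap X$ for $i=0,1,\dots,n$.
   Context: $X$ is identified with its canonical image in $X^{**}$; for $x^*\in\operatorname{dom} g=\{g<+\infty\}$, $\partial g(x^* )\cap X=\{x\in X:\langle y^*-x^*,x\rangle\le g(y^* )-g(x^* )\ \forall y^*\in X^*\}$ (empty outside $\operatorname{dom} g$), and $D(\partial g\cap X)=\{x^*:\partial g(x^* )\cap X\ne\emptyset\}$. $g^*|_X(x)=\sup_{x^*\in X^*}(\langle x^*,x\rangle-g(x^* ))$ for $x\in X$; interiors are in the norm topologies. *)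

theory Defs
  imports "HOL-Analysis.Analysis"
begin

text \<open>The dual space X* of a real Banach space 'a is modelled as the type of bounded
linear functionals 'a \<Rightarrow>L real (with its operator norm). The weak* topology is the
coarsest topology making all evaluations x* \<mapsto> x*(x), x \<in> X, continuous, i.e. the
pullback of the product topology on functions 'a \<Rightarrow> real.\<close>

definition weak_star_topology :: "('a::real_normed_vector \<Rightarrow>\<^sub>L real) topology" where
  "weak_star_topology =
     pullback_topology UNIV blinfun_apply (product_topology (\<lambda>_. euclideanreal) UNIV)"

definition edom :: "('b \<Rightarrow> ereal) \<Rightarrow> 'b set" where
  "edom g = {x. g x < \<infinity>}"

definition proper_fun :: "('b \<Rightarrow> ereal) \<Rightarrow> bool" where
  "proper_fun g \<longleftrightarrow> (\<forall>x. g x \<noteq> -\<infinity>) \<and> edom g \<noteq> {}"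

definition econvex :: "('b::real_vector \<Rightarrow> ereal) \<Rightarrow> bool" where
  "econvex g \<longleftrightarrow> (\<forall>x y t. 0 \<le> t \<and> t \<le> 1 \<longrightarrow>
      g ((1 - t) *\<^sub>R x + t *\<^sub>R y) \<le> ereal (1 - t) * g x + ereal t * g y)"

definition weak_star_lsc :: "(('a::real_normed_vector \<Rightarrow>\<^sub>L real) \<Rightarrow> ereal) \<Rightarrow> bool" where
  "weak_star_lsc g \<longleftrightarrow> (\<forall>c. closedin weak_star_topology {x. g x \<le> c})"

definition subdiff_X :: "(('a::real_normed_vector \<Rightarrow>\<^sub>L real) \<Rightarrow> ereal) \<Rightarrow> ('a \<Rightarrow>\<^sub>L real) \<Rightarrow> 'a set" where
  "subdiff_X g xs = {x. g xs < \<infinity> \<and>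
      (\<forall>ys. ereal (blinfun_apply (ys - xs) x) \<le> g ys - g xs)}"

definition dom_subdiff_X :: "(('a::real_normed_vector \<Rightarrow>\<^sub>L real) \<Rightarrow> ereal) \<Rightarrow> ('a \<Rightarrow>\<^sub>L real) set" where
  "dom_subdiff_X g = {xs. subdiff_X g xs \<noteq> {}}"

definition conj_X :: "(('a::real_normed_vector \<Rightarrow>\<^sub>L real) \<Rightarrow> ereal) \<Rightarrow> 'a \<Rightarrow> ereal" where
  "conj_X g x = (SUP xs. ereal (blinfun_apply xs x) - g xs)"

definition chain_sums :: "(('a::real_normed_vector \<Rightarrow>\<^sub>L real) \<Rightarrow> ereal) \<Rightarrow> ('a \<Rightarrow>\<^sub>L real) \<Rightarrow> ('a \<Rightarrow>\<^sub>L real) \<Rightarrow> real set" where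
  "chain_sums g x0s x_s = {(\<Sum>i<n. blinfun_apply (ys (Suc i) - ys i) (xv i))
        + blinfun_apply (x_s - ys n) (xv n) | n ys xv.
        ys 0 = x0s \<and> (\<forall>i\<le>n. xv i \<in> subdiff_X g (ys i))}"

end

theory Submission
  imports Defs
begin

text \<open>Write \<open>f\<close> for the conjugate of \<open>g\<close> on \<open>X\<close>, \<open>h\<close> for the chain supremum (plus the value of \<open>g\<close> at the
  base point) and \<open>k \<ge> f\<close> for the conjugate of \<open>h\<close>. A subgradient \<open>s \<in> X\<close> of \<open>g\<close> at \<open>l\<close> is one of \<open>h\<close> as
  well, so subgradients of \<open>f\<close> are subgradients of \<open>k\<close>. Adding \<open>(norm x)\<^sup>2 / 2\<close> makes the conjugates
  \<open>G\<close> of \<open>f\<close> and \<open>H\<close> of \<open>k\<close> finite and continuous on all of \<open>X*\<close>, and by Ekeland's principle they have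
  a common subgradient in \<open>X\<close> at a dense set of points. Integrating along segments, \<open>G - H\<close> is
  constant; conjugating back gives \<open>k \<le> f\<close>, hence \<open>g \<le> h\<close>.\<close>

section \<open>The Hahn-Banach sandwich theorem\<close>

text \<open>The obstacle is that \<open>f\<close> and \<open>k\<close> may be infinite and may lack
  subgradients on a segment of \<open>X\<close>, so their shared subgradients cannot be integrated
  there directly. The regularisation moves the integration to the dual space. If \<open>l\<close> is
  a subgradient of \<open>f\<close> and of \<open>k\<close> at \<open>s\<close>, and
  \<open>z\<close> is one of half the squared norm at \<open>s\<close>, then \<open>l + z\<close> is
  a subgradient of both regularised functions at \<open>s\<close>, and so \<open>s\<close> is a
  subgradient of both \<open>G\<close> and \<open>H\<close> at \<open>l + z\<close>. Hence only the
  points \<open>l + z\<close> have to be dense; this is where completeness of \<open>X\<close>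
  enters. Weak-star lower semicontinuity of \<open>g\<close> is what turns a subgradient
  \<open>l\<close> of \<open>f\<close> at \<open>s\<close> into
  \<open>s \<in> subdiff_X g l\<close>. The constant \<open>G - H\<close> is controlled at a
  subgradient of \<open>g\<close> at the base point, where \<open>f\<close> and \<open>k\<close>
  agree.\<close>

definition sublinear :: "('a::real_vector \<Rightarrow> real) \<Rightarrow> bool" where
  "sublinear p \<longleftrightarrow> (\<forall>x y. p (x + y) \<le> p x + p y) \<and> (\<forall>t x. 0 < t \<longrightarrow> p (t *\<^sub>R x) = t * p x)"

lemma sublinearI:
  assumes "\<And>x y. p (x + y) \<le> p x + p y"
    and "\<And>t x. 0 < t \<Longrightarrow> p (t *\<^sub>R x) \<le> t * p x"
  shows "sublinear p"
  unfolding sublinear_def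
proof (intro conjI allI impI)
  fix t :: real and x assume t: "0 < t"
  have "p x \<le> inverse t * p (t *\<^sub>R x)"
    using t assms(2)[of "inverse t" "t *\<^sub>R x"] by simp
  then have "t * p x \<le> p (t *\<^sub>R x)"
    using t by (simp add: field_simps)
  then show "p (t *\<^sub>R x) = t * p x"
    using assms(2)[OF t, of x] by linarith
qed (rule assms(1))

lemma sublinear_zero: "sublinear p \<Longrightarrow> p 0 = 0"
  unfolding sublinear_def by (metis add.right_neutral add_cancel_left_left mult_2 scaleR_zero_right zero_less_numeral)

lemma sublinear_neg: "sublinear p \<Longrightarrow> - p (- x) \<le> p x"
  using sublinear_zero[of p] unfolding sublinear_def by (metis add.right_inverse neg_le_iff_le minus_le_iff diff_0 diff_le_eq)

text \<open>The pointwise infimum works. It is finite because every member dominates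
  \<open>- p (- x)\<close>, and it is subadditive because the smaller of two comparable members
  serves both arguments at once.\<close>

lemma sublinear_lower_bound_of_chain:
  fixes p :: "'a::real_vector \<Rightarrow> real"
  assumes ne: "C \<noteq> {}" and C: "\<And>q. q \<in> C \<Longrightarrow> sublinear q \<and> (\<forall>x. q x \<le> p x)"
    and chain: "\<And>q r. q \<in> C \<Longrightarrow> r \<in> C \<Longrightarrow> (\<forall>x. q x \<le> r x) \<or> (\<forall>x. r x \<le> q x)"
  obtains u where "sublinear u" "\<And>q x. q \<in> C \<Longrightarrow> u x \<le> q x"
proof
  define u where "u x = (INF q\<in>C. q x)" for x
  have bdd: "bdd_below ((\<lambda>q. q x) ` C)" for x
  proof (rule bdd_belowI2)
    fix q assume "q \<in> C"
    then show "- p (- x) \<le> q x"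
      using C[of q] sublinear_neg[of q x] by (metis neg_le_iff_le order_trans)
  qed
  show le: "u x \<le> q x" if "q \<in> C" for q x
    unfolding u_def by (rule cINF_lower[OF bdd that])
  show "sublinear u"
  proof (rule sublinearI)
    fix x y
    have "u (x + y) - q y \<le> u x" if q: "q \<in> C" for q
      unfolding u_def[of x]
    proof (rule cINF_greatest[OF ne])
      fix r assume r: "r \<in> C"
      obtain m where m: "m \<in> C" "m x \<le> r x" "m y \<le> q y"
        using chain[OF q r] q r by (meson order_refl)
      have "u (x + y) \<le> m x + m y"
        using le[OF m(1), of "x + y"] C[OF m(1)] unfolding sublinear_def by (meson order_trans)
      then show "u (x + y) - q y \<le> r x" using m by linarith
    qed
    then have "u (x + y) - u x \<le> u y"
      unfolding u_def[of y] by (intro cINF_greatest[OF ne]) (simp add: algebra_simps)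
    then show "u (x + y) \<le> u x + u y" by simp
  next
    fix t :: real and x assume t: "0 < t"
    have "u (t *\<^sub>R x) / t \<le> u x"
      unfolding u_def[of x]
    proof (rule cINF_greatest[OF ne])
      fix q assume q: "q \<in> C"
      then have "q (t *\<^sub>R x) = t * q x" using C t unfolding sublinear_def by blast
      then show "u (t *\<^sub>R x) / t \<le> q x" using le[OF q, of "t *\<^sub>R x"] t by (simp add: field_simps)
    qed
    then show "u (t *\<^sub>R x) \<le> t * u x" using t by (simp add: field_simps)
  qed
qed

text \<open>Pushing \<open>p\<close> down along the ray through \<open>y\<close> keeps it sublinear.
  For a minimal \<open>p\<close> nothing can change, so the last bound becomes
  superadditivity.\<close>

lemma sublinear_tilt:
  fixes p :: "'a::real_vector \<Rightarrow> real"
  assumes p: "sublinear p"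
  obtains u where "sublinear u" "\<And>x. u x \<le> p x" "\<And>x. u x \<le> p (x + y) - p y"
proof
  define u where "u x = (INF t\<in>{0..}. p (x + t *\<^sub>R y) - t * p y)" for x
  have sub: "p (a + b) \<le> p a + p b" for a b using p unfolding sublinear_def by blast
  have hom: "p (t *\<^sub>R a) = t * p a" if "0 \<le> t" for t a
    using p that sublinear_zero[OF p] unfolding sublinear_def by (cases "t = 0") auto
  have bdd: "bdd_below ((\<lambda>t. p (x + t *\<^sub>R y) - t * p y) ` {0..})" for x
  proof (rule bdd_belowI2)
    fix t :: real assume "t \<in> {0..}"
    then show "- p (- x) \<le> p (x + t *\<^sub>R y) - t * p y"
      using sub[of "x + t *\<^sub>R y" "- x"] hom[of t y] by simp
  qed
  have le: "u x \<le> p (x + t *\<^sub>R y) - t * p y" if "0 \<le> t" for t x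
    unfolding u_def by (rule cINF_lower[OF bdd]) (use that in simp)
  show "u x \<le> p x" for x using le[of 0 x] by simp
  show "u x \<le> p (x + y) - p y" for x using le[of 1 x] by simp
  show "sublinear u"
  proof (rule sublinearI)
    fix a b
    have "u (a + b) - (p (b + s *\<^sub>R y) - s * p y) \<le> u a" if s: "0 \<le> s" for s
      unfolding u_def[of a]
    proof (rule cINF_greatest)
      fix t :: real assume t: "t \<in> {0..}"
      show "u (a + b) - (p (b + s *\<^sub>R y) - s * p y) \<le> p (a + t *\<^sub>R y) - t * p y"
        using le[of "t + s" "a + b"] s t sub[of "a + t *\<^sub>R y" "b + s *\<^sub>R y"]
        by (simp add: algebra_simps)
    qed simp
    then have "u (a + b) - u a \<le> u b"
      unfolding u_def[of b] by (intro cINF_greatest) (simp_all add: algebra_simps)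
    then show "u (a + b) \<le> u a + u b" by simp
  next
    fix c :: real and x assume c: "0 < c"
    have "u (c *\<^sub>R x) / c \<le> u x"
      unfolding u_def[of x]
    proof (rule cINF_greatest)
      fix t :: real assume t: "t \<in> {0..}"
      have "p (c *\<^sub>R (x + t *\<^sub>R y)) = c * p (x + t *\<^sub>R y)" using hom c by simp
      then show "u (c *\<^sub>R x) / c \<le> p (x + t *\<^sub>R y) - t * p y"
        using le[of "c * t" "c *\<^sub>R x"] c t by (simp add: field_simps scaleR_add_right)
    qed simp
    then show "u (c *\<^sub>R x) \<le> c * u x" using c by (simp add: field_simps)
  qed
qed

lemma linear_below_sublinear:
  fixes p :: "'a::real_vector \<Rightarrow> real"
  assumes p: "sublinear p"
  obtains L where "linear L" "\<And>x. L x \<le> p x"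
proof -
  define A where "A = {q. sublinear q \<and> (\<forall>x. q x \<le> p x)}"
  \<comment> \<open>The order is reversed, so that the maximal element supplied by Zorn's lemma is a
    pointwise minimal sublinear functional.\<close>
  define P where "P = (\<lambda>q r :: 'a \<Rightarrow> real. \<forall>x. r x \<le> q x)"
  have "\<exists>m\<in>A. \<forall>a\<in>A. P m a \<longrightarrow> a = m"
  proof (rule predicate_Zorn)
    show "partial_order_on A (relation_of P A)"
      unfolding partial_order_on_def preorder_on_def relation_of_def P_def
      by (auto simp: refl_on_def trans_def antisym_def intro!: ext order_antisym intro: order_trans)
  next
    fix C assume C: "C \<in> Chains (relation_of P A)"
    show "\<exists>u\<in>A. \<forall>a\<in>C. P a u"
    proof (cases "C = {}")
      case True
      then show ?thesis using p by (auto simp: A_def)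
    next
      case False
      have CA: "q \<in> A" if "q \<in> C" for q
        using C that by (auto simp: Chains_def relation_of_def)
      have cmp: "(\<forall>x. q x \<le> r x) \<or> (\<forall>x. r x \<le> q x)" if "q \<in> C" "r \<in> C" for q r
        using C that by (auto simp: Chains_def relation_of_def P_def)
      obtain u where u: "sublinear u" "\<And>q x. q \<in> C \<Longrightarrow> u x \<le> q x"
        by (rule sublinear_lower_bound_of_chain[OF False _ cmp, where p = p]) (use CA in \<open>auto simp: A_def\<close>)
      have "u \<in> A"
        using False u CA unfolding A_def by (blast intro: order_trans)
      then show ?thesis using u(2) by (auto simp: P_def)
    qed
  qed
  then obtain m where m: "m \<in> A" and min: "\<And>a. a \<in> A \<Longrightarrow> P m a \<Longrightarrow> a = m" by blast
  have sm: "sublinear m" and mp: "\<And>x. m x \<le> p x" using m by (auto simp: A_def)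
  have add: "m (x + y) = m x + m y" for x y
  proof (rule antisym)
    show "m (x + y) \<le> m x + m y" using sm unfolding sublinear_def by blast
    obtain u where u: "sublinear u" "\<And>x. u x \<le> m x" "\<And>x. u x \<le> m (x + y) - m y"
      using sublinear_tilt[OF sm] by blast
    have "u = m" using min[of u] u mp by (auto simp: A_def P_def intro: order_trans)
    then show "m x + m y \<le> m (x + y)" using u(3)[of x] by simp
  qed
  have neg: "m (- x) = - m x" for x
    using add[of x "- x"] sublinear_zero[OF sm] by simp
  have "m (t *\<^sub>R x) = t *\<^sub>R m x" for t x
  proof (cases t "0 :: real" rule: linorder_cases)
    case less
    then have "m ((- t) *\<^sub>R x) = (- t) * m x" using sm unfolding sublinear_def by (metis neg_0_less_iff_less)
    then show ?thesis using neg[of "t *\<^sub>R x"] by simp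
  qed (use sm sublinear_zero[OF sm] in \<open>auto simp: sublinear_def\<close>)
  with add have "linear m" by (intro linearI) auto
  then show thesis using that mp by blast
qed

text \<open>The conclusion says that some affine function with linear part \<open>L\<close> lies
  between \<open>- f\<close> on \<open>S\<close> and \<open>\<psi>\<close>. The value function
  \<open>d \<mapsto> INF x. \<psi> (x + d) + f x\<close> is convex and nonnegative at 0;
  \<open>Q\<close> is its perspective before minimising over \<open>x\<close>, and the infimum
  \<open>p\<close> over \<open>t\<close> and \<open>x\<close> is a sublinear function. Any linear
  \<open>L\<close> below \<open>p\<close> is the required one.\<close>

lemma convex_sandwich:
  fixes f \<psi> :: "'a::real_vector \<Rightarrow> real"
  assumes ne: "S \<noteq> {}" and f: "convex_on S f" and psi: "convex_on UNIV \<psi>"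
    and nonneg: "\<And>x. x \<in> S \<Longrightarrow> 0 \<le> f x + \<psi> x"
  obtains L where "linear L" "\<And>x y. x \<in> S \<Longrightarrow> L y - \<psi> y \<le> L x + f x"
proof -
  define Q where "Q t x d = t * (\<psi> (x + d /\<^sub>R t) + f x)" for t :: real and x d
  have S: "convex S" using f convex_on_imp_convex by blast
  have combine: "\<exists>x\<in>S. Q (t1 + t2) x (d1 + d2) \<le> Q t1 x1 d1 + Q t2 x2 d2"
    if t: "0 < t1" "0 < t2" and x: "x1 \<in> S" "x2 \<in> S" for t1 t2 x1 x2 d1 d2
  proof
    define a b where "a = t1 / (t1 + t2)" and "b = t2 / (t1 + t2)"
    have ab: "0 \<le> a" "0 \<le> b" "a + b = 1" "(t1 + t2) * a = t1" "(t1 + t2) * b = t2"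
      using t by (auto simp: a_def b_def add_divide_distrib[symmetric])
    let ?x = "a *\<^sub>R x1 + b *\<^sub>R x2"
    show "?x \<in> S" using S x ab by (auto simp: convex_def)
    have eq: "?x + (d1 + d2) /\<^sub>R (t1 + t2) = a *\<^sub>R (x1 + d1 /\<^sub>R t1) + b *\<^sub>R (x2 + d2 /\<^sub>R t2)"
    proof -
      have eqs: "a *\<^sub>R (d1 /\<^sub>R t1) = d1 /\<^sub>R (t1 + t2)" "b *\<^sub>R (d2 /\<^sub>R t2) = d2 /\<^sub>R (t1 + t2)"
        using t by (auto simp: a_def b_def divide_inverse)
      then show ?thesis unfolding scaleR_add_right eqs by (simp only: ac_simps)
    qed
    have "\<psi> (?x + (d1 + d2) /\<^sub>R (t1 + t2)) \<le> a * \<psi> (x1 + d1 /\<^sub>R t1) + b * \<psi> (x2 + d2 /\<^sub>R t2)"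
      unfolding eq using psi ab unfolding convex_on_def by blast
    moreover have "f ?x \<le> a * f x1 + b * f x2"
      using f ab x unfolding convex_on_def by blast
    ultimately have "Q (t1 + t2) ?x (d1 + d2) \<le> (t1 + t2) * ((a * \<psi> (x1 + d1 /\<^sub>R t1) + b * \<psi> (x2 + d2 /\<^sub>R t2)) + (a * f x1 + b * f x2))"
      unfolding Q_def using t by (intro mult_left_mono add_mono) auto
    also have "\<dots> = ((t1 + t2) * a) * (\<psi> (x1 + d1 /\<^sub>R t1) + f x1) + ((t1 + t2) * b) * (\<psi> (x2 + d2 /\<^sub>R t2) + f x2)"
      by (simp add: algebra_simps)
    finally show "Q (t1 + t2) ?x (d1 + d2) \<le> Q t1 x1 d1 + Q t2 x2 d2"
      by (simp add: ab Q_def)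
  qed
  define V where "V d = {Q t x d |t x. 0 < t \<and> x \<in> S}" for d
  define p where "p d = Inf (V d)" for d
  obtain x1 where x1: "x1 \<in> S" using ne by blast
  have Vne: "V d \<noteq> {}" for d using x1 zero_less_one unfolding V_def by blast
  have bdd: "bdd_below (V d)" for d
  proof (rule bdd_belowI)
    fix v assume "v \<in> V d"
    then obtain t x where v: "v = Q t x d" "0 < t" "x \<in> S" by (auto simp: V_def)
    \<comment> \<open>Adding the directions \<open>d\<close> and \<open>- d\<close> leads to
      direction 0, where \<open>Q\<close> is nonnegative by \<open>nonneg\<close>.\<close>
    obtain y where "y \<in> S" "Q (t + 1) y (d + - d) \<le> Q t x d + Q 1 x1 (- d)"
      using combine[OF v(2) zero_less_one v(3) x1] by blast
    then show "- Q 1 x1 (- d) \<le> v"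
      using nonneg[of y] v by (simp add: Q_def) (smt (verit) mult_nonneg_nonneg)
  qed
  have le: "p d \<le> Q t x d" if "0 < t" "x \<in> S" for t :: real and x d
    unfolding p_def by (rule cInf_lower[OF _ bdd]) (use that in \<open>auto simp: V_def\<close>)
  have greatest: "c \<le> p d" if "\<And>t x.  0 < t \<Longrightarrow> x \<in> S \<Longrightarrow> c \<le> Q t x d" for c d
    unfolding p_def by (rule cInf_greatest[OF Vne]) (use that in \<open>auto simp: V_def\<close>)
  have "sublinear p"
  proof (rule sublinearI)
    fix a b
    have "p (a + b) - p a \<le> p b"
    proof (rule greatest)
      fix t :: real and x assume tx: "0 < t" "x \<in> S"
      have "p (a + b) - Q t x b \<le> p a"
      proof (rule greatest)
        fix s :: real and y assume sy: "0 < s" "y \<in> S"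
        obtain z where z: "z \<in> S" "Q (s + t) z (a + b) \<le> Q s y a + Q t x b"
          using combine[OF sy(1) tx(1) sy(2) tx(2)] by blast
        show "p (a + b) - Q t x b \<le> Q s y a"
          using le[of "s + t" z "a + b"] z sy tx by simp
      qed
      then show "p (a + b) - p a \<le> Q t x b" by simp
    qed
    then show "p (a + b) \<le> p a + p b" by simp
  next
    fix c :: real and d assume c: "0 < c"
    have "p (c *\<^sub>R d) / c \<le> p d"
    proof (rule greatest)
      fix t :: real and x assume tx: "0 < t" "x \<in> S"
      have "Q (c * t) x (c *\<^sub>R d) = c * Q t x d"
        using c scaleR_scaleR[of "inverse (c * t)" c d] by (simp add: Q_def mult.commute[of _ c] flip: mult.assoc)
      then show "p (c *\<^sub>R d) / c \<le> Q t x d"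
        using le[of "c * t" x "c *\<^sub>R d"] c tx by (simp add: field_simps)
    qed
    then show "p (c *\<^sub>R d) \<le> c * p d" using c by (simp add: field_simps)
  qed
  then obtain L where L: "linear L" "\<And>x. L x \<le> p x" using linear_below_sublinear by blast
  have "L y - \<psi> y \<le> L x + f x" if "x \<in> S" for x y
    using L(2)[of "y - x"] le[of 1 x "y - x"] that linear_diff[OF L(1), of y x] by (simp add: Q_def)
  then show thesis using that L(1) by blast
qed

text \<open>The sandwich theorem yields a merely algebraic functional. Continuity of
  \<open>\<psi>\<close> at the contact point bounds it from above on a ball, and scaling gives a
  norm bound.\<close>

lemma linear_minorant_bounded:
  fixes L \<psi> :: "'a::real_normed_vector \<Rightarrow> real"
  assumes L: "linear L" and cont: "isCont \<psi> s" and le: "\<And>y. \<psi> s + L (y - s) \<le> \<psi> y"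
  obtains l :: "'a \<Rightarrow>\<^sub>L real" where "L = blinfun_apply l"
proof -
  obtain \<delta> where \<delta>: "0 < \<delta>" and close: "\<And>y. dist y s < \<delta> \<Longrightarrow> dist (\<psi> y) (\<psi> s) < 1"
    using cont unfolding continuous_at_eps_delta by (metis zero_less_one)
  have small: "L d \<le> 1" if "norm d < \<delta>" for d
    using le[of "s + d"] close[of "s + d"] that by (simp add: dist_norm)
  have bound: "L d \<le> norm d * (2 / \<delta>)" for d
  proof (cases "d = 0")
    case True
    then show ?thesis using linear_0[OF L] by simp
  next
    case False
    let ?c = "\<delta> / (2 * norm d)"
    have "norm (?c *\<^sub>R d) < \<delta>" using \<delta> False by simp
    then have "?c * L d \<le> 1" using small[of "?c *\<^sub>R d"] linear_scale[OF L, of ?c d] by simp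
    then show ?thesis using \<delta> False by (simp add: field_simps)
  qed
  have "norm (L d) \<le> norm d * (2 / \<delta>)" for d
    using bound[of d] bound[of "- d"] linear_neg[OF L, of d] by simp
  then have "bounded_linear L"
    using L by (intro bounded_linear_intro[where K = "2 / \<delta>"]) (auto simp: linear_add linear_scale)
  then show thesis using that[of "Blinfun L"] by (simp add: bounded_linear_Blinfun_apply)
qed

text \<open>Sum rule at a minimiser: after the minimum value is subtracted from
  \<open>\<psi>\<close>, the sandwiching affine function touches both sides at \<open>s\<close>. Its
  slope is a subgradient of \<open>\<psi>\<close>, and the opposite slope is one of
  \<open>f\<close>.\<close>

lemma subgradient_split:
  fixes f \<psi> :: "'a::real_normed_vector \<Rightarrow> real"
  assumes f: "convex_on S f" and psi: "convex_on UNIV \<psi>" and cont: "isCont \<psi> s"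
    and s: "s \<in> S" and min: "\<And>x. x \<in> S \<Longrightarrow> f s + \<psi> s \<le> f x + \<psi> x"
  obtains l :: "'a \<Rightarrow>\<^sub>L real"
  where "\<And>x. x \<in> S \<Longrightarrow> f s + l (x - s) \<le> f x" "\<And>y. \<psi> s - l (y - s) \<le> \<psi> y"
proof -
  have psi': "convex_on UNIV (\<lambda>x. \<psi> x + - (f s + \<psi> s))"
    by (intro convex_on_add psi) (simp only: convex_on_const convex_UNIV)
  have "S \<noteq> {}" "0 \<le> f x + (\<psi> x + - (f s + \<psi> s))" if "x \<in> S" for x
    using that min[of x] by auto
  then obtain L where L: "linear L"
    and le: "\<And>x y. x \<in> S \<Longrightarrow> L y - (\<psi> y + - (f s + \<psi> s)) \<le> L x + f x"
    using convex_sandwich[OF _ f psi'] s by blast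
  have "\<psi> s + L (y - s) \<le> \<psi> y" for y
    using le[OF s, of y] linear_diff[OF L, of y s] by simp
  then obtain l where l: "L = blinfun_apply l"
    using linear_minorant_bounded[OF L cont] by blast
  show thesis
  proof (rule that[of "- l"])
    show "f s + (- l) (x - s) \<le> f x" if "x \<in> S" for x
      using le[OF that, of s] by (simp add: l blinfun.diff_right blinfun.minus_left)
    show "\<psi> s - (- l) (y - s) \<le> \<psi> y" for y
      using le[OF s, of y] by (simp add: l blinfun.diff_right blinfun.minus_left)
  qed
qed

section \<open>Weak-star continuous affine minorants\<close>

lemma weak_star_nbhd:
  assumes U: "openin weak_star_topology U" and x: "x \<in> U"
  obtains F \<delta> where "finite F" "0 < \<delta>" "\<And>y. (\<And>v. v \<in> F \<Longrightarrow> \<bar>blinfun_apply (y - x) v\<bar> < \<delta>) \<Longrightarrow> y \<in> U"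
proof -
  obtain W where W: "openin (product_topology (\<lambda>_. euclideanreal) UNIV) W" "U = blinfun_apply -` W"
    using U unfolding weak_star_topology_def openin_pullback_topology by auto
  then have "\<exists>B. finite {i \<in> UNIV. B i \<noteq> topspace euclideanreal} \<and> (\<forall>i\<in>UNIV. openin euclideanreal (B i))
      \<and> blinfun_apply x \<in> Pi\<^sub>E UNIV B \<and> Pi\<^sub>E UNIV B \<subseteq> W"
    using x unfolding openin_product_topology_alt by blast
  then obtain B where fin: "finite {i. B i \<noteq> UNIV}" and op: "\<And>i. open (B i)"
    and xB: "blinfun_apply x \<in> Pi\<^sub>E UNIV B" and BW: "Pi\<^sub>E UNIV B \<subseteq> W"
    by auto
  have "\<exists>e>0. \<forall>r. \<bar>r - x v\<bar> < e \<longrightarrow> r \<in> B v" for v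
    using op[of v] xB unfolding open_dist dist_real_def by auto
  then obtain e where e: "\<And>v. 0 < e v" "\<And>v r. \<bar>r - x v\<bar> < e v \<Longrightarrow> r \<in> B v" by metis
  \<comment> \<open>The element 1 keeps the minimum meaningful when no coordinate is
    constrained.\<close>
  define \<delta> where "\<delta> = Min (insert 1 (e ` {i. B i \<noteq> UNIV}))"
  show thesis
  proof (rule that[OF fin, of \<delta>])
    show "0 < \<delta>" using fin e by (auto simp: \<delta>_def)
    fix y assume y: "\<And>v. v \<in> {i. B i \<noteq> UNIV} \<Longrightarrow> \<bar>blinfun_apply (y - x) v\<bar> < \<delta>"
    have "y v \<in> B v" for v
    proof (cases "B v = UNIV")
      case False
      then have "\<delta> \<le> e v" using fin by (auto simp: \<delta>_def)
      then show ?thesis using e(2)[of "y v" v] y[of v] False by (simp add: blinfun.diff_left)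
    qed simp
    then show "y \<in> U" using BW W(2) by auto
  qed
qed

text \<open>Weak-star continuous functionals are evaluations: induct on the number of points of \<open>F\<close>,
  correcting \<open>L\<close> by a multiple of the evaluation at the new point.\<close>

lemma linear_vanishing_imp_evaluation:
  fixes L :: "('a::real_normed_vector \<Rightarrow>\<^sub>L real) \<Rightarrow> real"
  assumes "finite F" "linear L" "\<And>d. (\<And>v. v \<in> F \<Longrightarrow> blinfun_apply d v = 0) \<Longrightarrow> L d = 0"
  shows "\<exists>w. \<forall>d. L d = blinfun_apply d w"
  using assms
proof (induction F arbitrary: L)
  case empty
  then show ?case by (intro exI[of _ 0]) simp
next
  case (insert a F)
  show ?case
  proof (cases "\<exists>e :: 'a \<Rightarrow>\<^sub>L real. e a \<noteq> 0 \<and> (\<forall>v\<in>F. e v = 0)")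
    case True
    then obtain e :: "'a \<Rightarrow>\<^sub>L real" where e: "e a \<noteq> 0" "\<And>v. v \<in> F \<Longrightarrow> e v = 0" by blast
    define c where "c = L e / e a"
    have "\<exists>w. \<forall>d. L d - c * d a = blinfun_apply d w"
    proof (rule insert.IH)
      show "linear (\<lambda>d :: 'a \<Rightarrow>\<^sub>L real. L d - c * d a)"
        using insert.prems(1)
        by (intro linearI) (auto simp: linear_add linear_scale blinfun.add_left blinfun.scaleR_left algebra_simps)
      fix d :: "'a \<Rightarrow>\<^sub>L real" assume d: "\<And>v. v \<in> F \<Longrightarrow> d v = 0"
      have "L (d - (d a / e a) *\<^sub>R e) = 0"
        by (rule insert.prems(2)) (use d e in \<open>auto simp: blinfun.diff_left blinfun.scaleR_left\<close>)
      then show "L d - c * d a = 0"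
        using insert.prems(1) e by (simp add: linear_diff linear_scale c_def)
    qed
    then obtain w where "\<And>d. L d - c * d a = blinfun_apply d w" by blast
    then have "L d = blinfun_apply d (w + c *\<^sub>R a)" for d
      by (simp add: blinfun.add_right blinfun.scaleR_right algebra_simps flip: \<open>\<And>d. L d - c * d a = blinfun_apply d w\<close>)
    then show ?thesis by blast
  next
    case False
    \<comment> \<open>Here every functional vanishing on \<open>F\<close> also vanishes at
      \<open>a\<close>, so the point \<open>a\<close> imposes no further condition.\<close>
    then show ?thesis by (intro insert.IH insert.prems) auto
  qed
qed

lemma ereal_real_edom:
  assumes "\<And>x. g x \<noteq> - \<infinity>" "x \<in> edom g"
  shows "g x = ereal (real_of_ereal (g x))"
  using assms(1)[of x] assms(2) by (cases "g x") (auto simp: edom_def)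

text \<open>Since \<open>real_of_ereal\<close> sends infinity to 0, the passage to real values is
  made on \<open>edom g\<close> only.\<close>

lemma econvex_imp_convex_on:
  assumes g: "econvex g" and ninf: "\<And>x. g x \<noteq> - \<infinity>"
  shows "convex_on (edom g) (\<lambda>x. real_of_ereal (g x))"
proof -
  have key: "g ((1 - t) *\<^sub>R x + t *\<^sub>R y) \<le> ereal ((1 - t) * real_of_ereal (g x) + t * real_of_ereal (g y))"
    if "x \<in> edom g" "y \<in> edom g" "0 \<le> t" "t \<le> 1" for x y t
  proof -
    have "g ((1 - t) *\<^sub>R x + t *\<^sub>R y) \<le> ereal (1 - t) * g x + ereal t * g y"
      using g that unfolding econvex_def by blast
    then show ?thesis
      by (subst (asm) ereal_real_edom[OF ninf that(1)], subst (asm) ereal_real_edom[OF ninf that(2)]) simp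
  qed
  have dom: "(1 - t) *\<^sub>R x + t *\<^sub>R y \<in> edom g"
    if "x \<in> edom g" "y \<in> edom g" "0 \<le> t" "t \<le> 1" for x y t
    using key[OF that] unfolding edom_def by (auto intro: le_less_trans)
  show ?thesis
  proof (rule convex_onI)
    show "convex (edom g)"
      unfolding convex_alt using dom by blast
    fix t x y assume t: "(0::real) < t" "t < 1" and x: "x \<in> edom g" "y \<in> edom g"
    show "real_of_ereal (g ((1 - t) *\<^sub>R x + t *\<^sub>R y)) \<le> (1 - t) * real_of_ereal (g x) + t * real_of_ereal (g y)"
      using key[of x y t] ereal_real_edom[of g, OF ninf dom[of x y t]] t x
      by (metis ereal_less_eq(3) less_imp_le)
  qed
qed

text \<open>Below \<open>g\<close> lies the concave function \<open>y \<mapsto> r - M * m y\<close>, where \<open>m\<close> is a weak-star continuous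
  seminorm of \<open>y - x\<close> that also dominates the linear part of the given affine minorant; an affine
  function in between is automatically weak-star continuous.\<close>

lemma weak_star_affine_minorant:
  fixes g :: "('a::real_normed_vector \<Rightarrow>\<^sub>L real) \<Rightarrow> ereal"
  assumes conv: "econvex g" and lsc: "weak_star_lsc g" and ne: "edom g \<noteq> {}"
    and minorant: "\<And>y. ereal (blinfun_apply y u - b) \<le> g y" and less: "ereal r < g x"
  obtains v where "\<And>y. ereal (r + blinfun_apply (y - x) v) \<le> g y"
proof -
  have ninf: "g y \<noteq> - \<infinity>" for y using minorant[of y] by auto
  define f where "f y = real_of_ereal (g y)" for y
  have gf: "g y = ereal (f y)" if "y \<in> edom g" for y
    unfolding f_def using ereal_real_edom[of g, OF ninf that] .
  have "openin weak_star_topology {y. \<not> g y \<le> ereal r}"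
  proof -
    have top: "topspace weak_star_topology = (UNIV :: ('a \<Rightarrow>\<^sub>L real) set)"
      by (simp add: weak_star_topology_def topspace_pullback_topology)
    have "UNIV - {y. g y \<le> ereal r} = {y. \<not> g y \<le> ereal r}" by blast
    then show ?thesis
      using lsc[unfolded weak_star_lsc_def, rule_format, of "ereal r"] top
      by (metis closedin_def)
  qed
  moreover have "x \<in> {y. \<not> g y \<le> ereal r}" using less by simp
  ultimately obtain F \<delta> where F: "finite F" "0 < \<delta>"
    and nbhd: "\<And>y. (\<And>v. v \<in> F \<Longrightarrow> \<bar>blinfun_apply (y - x) v\<bar> < \<delta>) \<Longrightarrow> \<not> g y \<le> ereal r"
    by (rule weak_star_nbhd) blast
  define m where "m y = (\<Sum>v\<in>insert u F. \<bar>blinfun_apply (y - x) v\<bar>)" for y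
  have m: "\<bar>blinfun_apply (y - x) v\<bar> \<le> m y" if "v \<in> insert u F" for y v
    unfolding m_def using F that by (intro member_le_sum) auto
  \<comment> \<open>One unit of slope absorbs the variation of the given minorant, which is at most
    \<open>m y\<close>. The remainder, multiplied by \<open>m y \<ge> \<delta>\<close>, pays for the
    constant gap outside the neighbourhood.\<close>
  define M where "M = 1 + \<bar>r + b - x u\<bar> / \<delta>"
  have M: "0 \<le> M" using F by (simp add: M_def)
  define \<psi> where "\<psi> y = M * m y + - r" for y
  have "convex_on UNIV m"
  proof (rule convex_onI)
    fix t and y z :: "'a \<Rightarrow>\<^sub>L real" assume t: "(0::real) < t" "t < 1"
    have "\<bar>blinfun_apply (((1 - t) *\<^sub>R y + t *\<^sub>R z) - x) v\<bar> \<le> (1 - t) * \<bar>(y - x) v\<bar> + t * \<bar>(z - x) v\<bar>" for v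
    proof -
      have "((1 - t) *\<^sub>R y + t *\<^sub>R z) - x = (1 - t) *\<^sub>R (y - x) + t *\<^sub>R (z - x)"
        by (simp add: algebra_simps)
      then have "blinfun_apply (((1 - t) *\<^sub>R y + t *\<^sub>R z) - x) v = (1 - t) * (y - x) v + t * (z - x) v"
        by (simp add: blinfun.add_left blinfun.scaleR_left)
      then show ?thesis
        using t abs_triangle_ineq[of "(1 - t) * (y - x) v" "t * (z - x) v"] by (simp add: abs_mult)
    qed
    then have "m ((1 - t) *\<^sub>R y + t *\<^sub>R z) \<le> (\<Sum>v\<in>insert u F. (1 - t) * \<bar>(y - x) v\<bar> + t * \<bar>(z - x) v\<bar>)"
      unfolding m_def by (intro sum_mono)
    also have "\<dots> = (1 - t) * m y + t * m z"
      unfolding m_def sum.distrib sum_distrib_left ..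
    finally show "m ((1 - t) *\<^sub>R y + t *\<^sub>R z) \<le> (1 - t) * m y + t * m z" .
  qed simp
  then have psi: "convex_on UNIV \<psi>"
    unfolding \<psi>_def using M by (intro convex_on_add convex_on_cmul) (simp_all only: convex_on_const convex_UNIV)
  have nonneg: "0 \<le> f y + \<psi> y" if y: "y \<in> edom g" for y
  proof (cases "m y < \<delta>")
    case True
    have "\<not> g y \<le> ereal r"
      by (rule nbhd) (use m True in \<open>force intro: le_less_trans\<close>)
    moreover have "0 \<le> M * m y" using M m[of u y] by (intro mult_nonneg_nonneg) auto
    ultimately show ?thesis using gf[OF y] by (simp add: \<psi>_def)
  next
    case False
    have "\<bar>r + b - x u\<bar> \<le> (M - 1) * m y"
      using False F mult_left_mono[of \<delta> "m y" "\<bar>r + b - x u\<bar> / \<delta>"] by (simp add: M_def)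
    moreover have "y u - b \<le> f y" using minorant[of y] gf[OF y] by simp
    ultimately show ?thesis
      using m[of u y] by (simp add: \<psi>_def blinfun.diff_left algebra_simps)
  qed
  obtain L where L: "linear L" and le: "\<And>z y. z \<in> edom g \<Longrightarrow> L y - \<psi> y \<le> L z + f z"
    using convex_sandwich[OF ne econvex_imp_convex_on[OF conv ninf, folded f_def] psi nonneg] by blast
  have "L d = 0" if d: "\<And>v. v \<in> insert u F \<Longrightarrow> blinfun_apply d v = 0" for d
  proof (rule ccontr)
    assume nz: "L d \<noteq> 0"
    obtain z where z: "z \<in> edom g" using ne by blast
    \<comment> \<open>Moving along \<open>d\<close> leaves \<open>m\<close> at 0, so
      \<open>L\<close> is bounded above on this line; this \<open>t\<close> overshoots the bound by
      exactly 1.\<close>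
    define t where "t = (L z + f z - r - L x + 1) / L d"
    have "m (x + t *\<^sub>R d) = 0" unfolding m_def using d by (simp add: blinfun.scaleR_left)
    then have "L x + t * L d + r \<le> L z + f z"
      using le[OF z, of "x + t *\<^sub>R d"] L by (simp add: \<psi>_def linear_add linear_scale)
    then show False using nz by (simp add: t_def)
  qed
  then obtain w where w: "\<And>d. L d = blinfun_apply d w"
    using linear_vanishing_imp_evaluation[of "insert u F" L] F L by auto
  show thesis
  proof (rule that[of "- w"])
    fix y
    show "ereal (r + blinfun_apply (y - x) (- w)) \<le> g y"
    proof (cases "y \<in> edom g")
      case True
      have "m x = 0" by (simp add: m_def)
      then show ?thesis
        using le[OF True, of x] gf[OF True] by (simp add: \<psi>_def w blinfun.diff_left blinfun.minus_right)
    qed (simp add: edom_def)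
  qed
qed

section \<open>Ekeland's principle\<close>

text \<open>\<open>T x\<close> collects the points that improve on \<open>x\<close> by at least
  \<open>e\<close> times their distance. Near-minimisers chosen successively in these sets form a
  Cauchy sequence, because the total decrease is finite; a real improvement on the limit would
  contradict the near-minimality. Closed sublevel sets within \<open>S\<close> express lower
  semicontinuity of \<open>F\<close> extended by infinity.\<close>

lemma ekeland_variational_principle:
  fixes F :: "'a::complete_space \<Rightarrow> real"
  assumes closed: "\<And>c. closed {x \<in> S. F x \<le> c}" and ne: "S \<noteq> {}"
    and bdd: "\<And>x. x \<in> S \<Longrightarrow> m \<le> F x" and e: "0 < e"
  obtains s where "s \<in> S" "\<And>x. x \<in> S \<Longrightarrow> F s \<le> F x + e * dist x s"
proof -
  define T where "T x = {y \<in> S. F y + e * dist x y \<le> F x}" for x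
  have T_refl: "x \<in> T x" if "x \<in> S" for x using that by (simp add: T_def)
  have T_trans: "z \<in> T x" if "y \<in> T x" "z \<in> T y" for x y z
    using that e mult_left_mono[OF dist_triangle[of x z y], of e]
    by (auto simp: T_def algebra_simps)
  have step: "\<exists>y. y \<in> T x \<and> (\<forall>z\<in>T x. F y \<le> F z + inverse (Suc n))" if x: "x \<in> S" for x n
  proof -
    have ne': "F ` T x \<noteq> {}" using T_refl[OF x] by blast
    have bb: "bdd_below (F ` T x)" using bdd by (intro bdd_belowI2[of _ m]) (auto simp: T_def)
    obtain y where y: "y \<in> T x" "F y < Inf (F ` T x) + inverse (Suc n)"
      using cInf_lessD[OF ne', of "Inf (F ` T x) + inverse (Suc n)"] by auto
    show ?thesis
      using y cInf_lower[OF _ bb] by (metis add_mono_thms_linordered_semiring(3) imageI less_imp_le order_trans)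
  qed
  obtain a where a: "a \<in> S" using ne by blast
  have "\<exists>X. X 0 = a \<and> (\<forall>n. X n \<in> S \<and> (X (Suc n) \<in> T (X n) \<and>
      (\<forall>z\<in>T (X n). F (X (Suc n)) \<le> F z + inverse (Suc n))))"
  proof -
    have "\<exists>X. \<forall>n. (X n \<in> S \<and> (n = 0 \<longrightarrow> X n = a)) \<and> (X (Suc n) \<in> T (X n) \<and>
        (\<forall>z\<in>T (X n). F (X (Suc n)) \<le> F z + inverse (Suc n)))"
      by (rule dependent_nat_choice) (use a step in \<open>auto simp: T_def\<close>)
    then show ?thesis by blast
  qed
  then obtain X where XS: "\<And>n. X n \<in> S" and XT: "\<And>n. X (Suc n) \<in> T (X n)"
    and Xmin: "\<And>n z. z \<in> T (X n) \<Longrightarrow> F (X (Suc n)) \<le> F z + inverse (Suc n)" by blast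
  have mono: "X k \<in> T (X n)" if "n \<le> k" for n k
    using that by (induction k rule: dec_induct) (use T_refl XS XT T_trans in blast)+
  have dist_le: "e * dist (X n) (X k) \<le> F (X n) - F (X k)" if "n \<le> k" for n k
    using mono[OF that] by (simp add: T_def)
  have dec: "decseq (\<lambda>n. F (X n))"
    unfolding decseq_def using dist_le e by (smt (verit) mult_nonneg_nonneg zero_le_dist)
  have "\<bar>F (X n)\<bar> \<le> \<bar>m\<bar> + \<bar>F (X 0)\<bar>" for n
    using bdd[OF XS[of n]] decseqD[OF dec le0[of n]] by linarith
  then have "Bseq (\<lambda>n. F (X n))" by (intro BseqI') simp
  then have "convergent (\<lambda>n. F (X n))"
    using dec by (intro Bseq_monoseq_convergent decseq_imp_monoseq)
  then have FC: "Cauchy (\<lambda>n. F (X n))" by (rule convergent_Cauchy)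
  have "Cauchy X"
  proof (rule metric_CauchyI)
    fix \<epsilon> :: real assume \<epsilon>: "0 < \<epsilon>"
    then obtain N where N: "\<And>i j. N \<le> i \<Longrightarrow> N \<le> j \<Longrightarrow> dist (F (X i)) (F (X j)) < e * \<epsilon>"
      using metric_CauchyD[OF FC, of "e * \<epsilon>"] e by (metis mult_pos_pos)
    have *: "dist (X i) (X j) < \<epsilon>" if "N \<le> i" "i \<le> j" for i j
      using dist_le[OF that(2)] N[of i j] that e by (smt (verit) dist_real_def mult_le_cancel_left_pos order_trans)
    show "\<exists>N. \<forall>i\<ge>N. \<forall>j\<ge>N. dist (X i) (X j) < \<epsilon>"
      using * by (metis dist_commute nle_le)
  qed
  then obtain s where s: "X \<longlonglongrightarrow> s" using Cauchy_convergent convergent_def by blast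
  have sT: "s \<in> T (X n)" for n
  proof -
    \<comment> \<open>The bound contains the distance to \<open>s\<close> instead of to
      \<open>X k\<close>, so that it is a constant sublevel; the slack \<open>\<delta>\<close>
      absorbs the difference for large \<open>k\<close>.\<close>
    have *: "s \<in> {x \<in> S. F x \<le> F (X n) - e * dist (X n) s + \<delta>}" if \<delta>: "0 < \<delta>" for \<delta>
    proof (rule Lim_in_closed_set[OF closed _ _ s])
      have "\<forall>\<^sub>F k in sequentially. dist (X k) s < \<delta> / e"
        using s \<delta> e by (intro tendstoD) auto
      then show "\<forall>\<^sub>F k in sequentially. X k \<in> {x \<in> S. F x \<le> F (X n) - e * dist (X n) s + \<delta>}"
        using eventually_ge_at_top[of n]
      proof eventually_elim
        case (elim k)
        have "dist (X n) s \<le> dist (X n) (X k) + dist (X k) s" by (rule dist_triangle)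
        then have "e * dist (X n) s \<le> e * dist (X n) (X k) + e * dist (X k) s"
          using e by (metis distrib_left mult_left_mono less_imp_le)
        moreover have "e * dist (X k) s < \<delta>" using elim(1) e by (simp add: field_simps)
        ultimately show ?case using dist_le[OF elim(2)] XS by simp
      qed
    qed simp
    have "F s \<le> F (X n) - e * dist (X n) s"
      by (rule field_le_epsilon) (use * in simp)
    then show ?thesis using *[of 1] by (simp add: T_def)
  qed
  show thesis
  proof
    show "s \<in> S" using sT[of 0] by (simp add: T_def)
    fix y assume y: "y \<in> S"
    show "F s \<le> F y + e * dist y s"
    proof (rule ccontr)
      assume "\<not> F s \<le> F y + e * dist y s"
      then have less: "F y + e * dist s y < F s" by (simp add: dist_commute)
      then have "y \<in> T s" using y by (simp add: T_def)
      then have "F s \<le> F y + inverse (Suc n)" for n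
        using Xmin[OF T_trans[OF sT], of y n] sT[of "Suc n"] e unfolding T_def
        by (smt (verit) mem_Collect_eq mult_nonneg_nonneg zero_le_dist)
      moreover have "0 < F s - F y" using less e by (smt (verit) mult_nonneg_nonneg zero_le_dist)
      ultimately show False using reals_Archimedean[of "F s - F y"] by (smt (verit))
    qed
  qed
qed

section \<open>Half the squared norm and its subgradients\<close>

lemma convex_on_half_norm_square:
  "convex_on UNIV (\<lambda>x :: 'a::real_normed_vector. (norm x)\<^sup>2 / 2)"
proof (rule convex_onI)
  fix t :: real and x y :: 'a assume t: "0 < t" "t < 1"
  have "norm ((1 - t) *\<^sub>R x + t *\<^sub>R y) \<le> (1 - t) * norm x + t * norm y"
    using norm_triangle_ineq[of "(1 - t) *\<^sub>R x" "t *\<^sub>R y"] t by simp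
  then have "(norm ((1 - t) *\<^sub>R x + t *\<^sub>R y))\<^sup>2 \<le> ((1 - t) * norm x + t * norm y)\<^sup>2"
    by (intro power_mono) auto
  also have "\<dots> \<le> (1 - t) * (norm x)\<^sup>2 + t * (norm y)\<^sup>2"
  proof -
    have "(1 - t) * (norm x)\<^sup>2 + t * (norm y)\<^sup>2 - ((1 - t) * norm x + t * norm y)\<^sup>2
        = (1 - t) * t * (norm x - norm y)\<^sup>2" by (simp add: power2_eq_square algebra_simps)
    moreover have "0 \<le> (1 - t) * t * (norm x - norm y)\<^sup>2" using t by simp
    ultimately show ?thesis by linarith
  qed
  finally show "(norm ((1 - t) *\<^sub>R x + t *\<^sub>R y))\<^sup>2 / 2 \<le> (1 - t) * ((norm x)\<^sup>2 / 2) + t * ((norm y)\<^sup>2 / 2)"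
    by simp
qed simp

text \<open>On the singleton \<open>{x}\<close> minimality is trivial, so the splitting lemma with
  the zero function there yields a subgradient.\<close>

lemma half_norm_square_subgradient:
  fixes x :: "'a::real_normed_vector"
  obtains z :: "'a \<Rightarrow>\<^sub>L real" where "\<And>y. (norm x)\<^sup>2 / 2 + z (y - x) \<le> (norm y)\<^sup>2 / 2"
proof -
  have "convex_on {x} (\<lambda>_. 0 :: real)" by (simp add: convex_on_const)
  then obtain l :: "'a \<Rightarrow>\<^sub>L real" where "\<And>y. (norm x)\<^sup>2 / 2 - l (y - x) \<le> (norm y)\<^sup>2 / 2"
    by (rule subgradient_split[OF _ convex_on_half_norm_square, of "{x}" "\<lambda>_. 0" x])
      (auto intro!: continuous_intros)
  then show thesis by (intro that[of "- l"]) (simp add: blinfun.minus_left)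
qed

section \<open>Conjugates and dense subgradients\<close>

lemma conj_X_upper: "ereal (blinfun_apply xs x) - h xs \<le> conj_X h x"
  unfolding conj_X_def by (rule SUP_upper) simp

lemma conj_X_least:
  assumes "\<And>xs. ereal (blinfun_apply xs x - c) \<le> h xs"
  shows "conj_X h x \<le> ereal c"
  unfolding conj_X_def
proof (rule SUP_least)
  fix xs show "ereal (blinfun_apply xs x) - h xs \<le> ereal c"
    using assms[of xs] by (cases "h xs") auto
qed

lemma conj_X_antimono: "(\<And>xs. h xs \<le> g xs) \<Longrightarrow> conj_X g x \<le> conj_X h x"
  unfolding conj_X_def by (intro SUP_mono) (auto intro!: ereal_minus_mono)

text \<open>Equality case of the Fenchel-Young inequality. It is used for \<open>g\<close> and for
  the chain supremum alike.\<close>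

lemma conj_X_eq:
  assumes r: "h xs = ereal r" and sub: "\<And>ys. h xs + ereal (blinfun_apply (ys - xs) s) \<le> h ys"
  shows "conj_X h s = ereal (xs s - r)"
proof (rule antisym)
  show "conj_X h s \<le> ereal (xs s - r)"
    using sub by (intro conj_X_least) (simp add: r blinfun.diff_left algebra_simps)
  show "ereal (xs s - r) \<le> conj_X h s"
    using conj_X_upper[of xs s h] by (simp add: r)
qed

lemma conj_X_econvex:
  assumes ninf: "\<And>xs. h xs \<noteq> - \<infinity>"
  shows "econvex (conj_X h)"
  unfolding econvex_def
proof (intro allI impI)
  fix x y and t :: real assume t: "0 \<le> t \<and> t \<le> 1"
  show "conj_X h ((1 - t) *\<^sub>R x + t *\<^sub>R y) \<le> ereal (1 - t) * conj_X h x + ereal t * conj_X h y"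
    unfolding conj_X_def[of h "(1 - t) *\<^sub>R x + t *\<^sub>R y"]
  proof (rule SUP_least)
    fix xs
    show "ereal (blinfun_apply xs ((1 - t) *\<^sub>R x + t *\<^sub>R y)) - h xs
        \<le> ereal (1 - t) * conj_X h x + ereal t * conj_X h y"
    proof (cases "h xs")
      case (real r)
      have "ereal (1 - t) * ereal (xs x - r) + ereal t * ereal (xs y - r)
          \<le> ereal (1 - t) * conj_X h x + ereal t * conj_X h y"
        using t conj_X_upper[of xs x h] conj_X_upper[of xs y h]
        by (intro add_mono ereal_mult_left_mono) (simp_all add: real)
      moreover have "(1 - t) * (xs x - r) + t * (xs y - r) = xs ((1 - t) *\<^sub>R x + t *\<^sub>R y) - r"
        by (simp add: blinfun.add_right blinfun.diff_right blinfun.scaleR_right algebra_simps)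
      ultimately show ?thesis by (simp add: real)
    qed (use ninf in auto)
  qed
qed

text \<open>The conjugate is a supremum of continuous affine functions. Comparing it with a
  continuous \<open>\<phi>\<close> allows the perturbation in Ekeland's principle to be moved to the
  right-hand side.\<close>

lemma conj_X_closed_sublevel:
  fixes h :: "('a::real_normed_vector \<Rightarrow>\<^sub>L real) \<Rightarrow> ereal"
  assumes "continuous_on UNIV \<phi>"
  shows "closed {x. conj_X h x \<le> ereal (\<phi> x)}"
proof -
  have "{x. conj_X h x \<le> ereal (\<phi> x)} = (\<Inter>xs. {x. ereal (blinfun_apply xs x) - h xs \<le> ereal (\<phi> x)})"
    by (auto simp: conj_X_def SUP_le_iff)
  moreover have "closed {x. ereal (blinfun_apply xs x) - h xs \<le> ereal (\<phi> x)}" for xs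
  proof (cases "h xs")
    case (real r)
    have "closed {x. blinfun_apply xs x - r \<le> \<phi> x}"
      using assms by (intro closed_Collect_le continuous_intros)
    then show ?thesis by (simp add: real)
  qed auto
  ultimately show ?thesis by auto
qed

text \<open>Inversion of subgradients needs \<open>g l\<close> to equal its biconjugate value. If
  \<open>g l\<close> were larger, a weak-star continuous affine minorant of \<open>g\<close> with
  slope \<open>v\<close>, exceeding that value at \<open>l\<close>, would make the conjugate at
  \<open>v\<close> too small for \<open>l\<close> to be a subgradient at \<open>s\<close>.\<close>

lemma conj_X_subgradient_imp_subdiff_X:
  fixes g :: "('a::real_normed_vector \<Rightarrow>\<^sub>L real) \<Rightarrow> ereal"
  assumes conv: "econvex g" and lsc: "weak_star_lsc g" and ne: "edom g \<noteq> {}"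
    and minorant: "\<And>y. ereal (blinfun_apply y u - b) \<le> g y"
    and s: "conj_X g s = ereal c"
    and sub: "\<And>x. ereal (c + blinfun_apply l (x - s)) \<le> conj_X g x"
  shows "s \<in> subdiff_X g l"
proof -
  have ge: "ereal (blinfun_apply y s - c) \<le> g y" for y
    using conj_X_upper[of y s g] s by (cases "g y") auto
  have le: "g l \<le> ereal (l s - c)"
  proof (rule ccontr)
    assume "\<not> ?thesis"
    then obtain r where r: "l s - c < r" "ereal r < g l"
      by (metis ereal_dense2 ereal_less_eq(3) less_ereal.simps(1) not_le)
    obtain v where "\<And>y. ereal (r + blinfun_apply (y - l) v) \<le> g y"
      using weak_star_affine_minorant[OF conv lsc ne minorant r(2)] by blast
    then have "conj_X g v \<le> ereal (l v - r)"
      by (intro conj_X_least) (simp add: blinfun.diff_left algebra_simps)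
    then have "ereal (c + l (v - s)) \<le> ereal (l v - r)"
      using sub[of v] by (rule order_trans[rotated])
    then show False using r(1) by (simp add: blinfun.diff_right)
  qed
  with ge[of l] have gl: "g l = ereal (l s - c)" by (rule antisym[rotated])
  show ?thesis
    unfolding subdiff_X_def
  proof (intro CollectI conjI allI)
    show "g l < \<infinity>" by (simp add: gl)
    fix y show "ereal (blinfun_apply (y - l) s) \<le> g y - g l"
      using ge[of y] by (cases "g y") (auto simp: gl blinfun.diff_left)
  qed
qed

text \<open>Ekeland's principle gives a point \<open>s\<close> minimising
  \<open>x \<mapsto> conj_X g x + (norm x)\<^sup>2 / 2 - p x + e * norm (x - s)\<close>; splitting this sum twice
  yields \<open>l\<close> and \<open>z\<close>.\<close>

lemma dense_regularised_subgradients: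
  fixes g :: "('a::banach \<Rightarrow>\<^sub>L real) \<Rightarrow> ereal"
  assumes conv: "econvex g" and lsc: "weak_star_lsc g" and ninf: "\<And>y. g y \<noteq> - \<infinity>"
    and finite: "g x0s = ereal r0"
    and minorant: "\<And>y. ereal (blinfun_apply y u - b) \<le> g y"
    and e: "0 < e"
  obtains s l z where "s \<in> subdiff_X g l"
    "\<And>y. (norm s)\<^sup>2 / 2 + blinfun_apply z (y - s) \<le> (norm y)\<^sup>2 / 2" "norm (l + z - p) \<le> e"
proof -
  define S where "S = edom (conj_X g)"
  define f where "f x = real_of_ereal (conj_X g x)" for x
  have fg: "ereal (x0s x - r0) \<le> conj_X g x" for x
    using conj_X_upper[of x0s x g] by (simp add: finite)
  have fninf: "conj_X g x \<noteq> - \<infinity>" for x using fg[of x] by auto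
  have f: "conj_X g x = ereal (f x)" if "x \<in> S" for x
    unfolding f_def using ereal_real_edom[of "conj_X g", OF fninf] that by (simp add: S_def)
  have f_ge: "x0s x - r0 \<le> f x" if "x \<in> S" for x using fg[of x] f[OF that] by simp
  have fconv: "convex_on S f"
    unfolding S_def f_def by (intro econvex_imp_convex_on conj_X_econvex ninf fninf)
  have "conj_X g u \<le> ereal b" using minorant by (rule conj_X_least)
  then have uS: "u \<in> S" unfolding S_def edom_def by (auto intro: le_less_trans)
  define q where "q x = (norm x)\<^sup>2 / 2" for x :: 'a
  have qconv: "convex_on UNIV q" unfolding q_def by (rule convex_on_half_norm_square)
  have blin: "convex_on UNIV (\<lambda>x. blinfun_apply l x)" for l :: "'a \<Rightarrow>\<^sub>L real"
    by (rule convex_onI) (simp_all add: blinfun.add_right blinfun.scaleR_right)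
  define F where "F x = f x + (q x - p x)" for x
  have closed: "closed {x \<in> S. F x \<le> c}" for c
  proof -
    have "{x \<in> S. F x \<le> c} = {x. conj_X g x \<le> ereal (c - (q x - p x))}"
    proof (intro Collect_cong iffI)
      fix x assume "conj_X g x \<le> ereal (c - (q x - p x))"
      moreover from this have "x \<in> S" by (auto simp: S_def edom_def intro: le_less_trans)
      ultimately show "x \<in> S \<and> F x \<le> c" using f[of x] by (simp add: F_def)
    qed (auto simp: F_def f)
    then show ?thesis
      by (auto simp: q_def intro!: conj_X_closed_sublevel continuous_intros)
  qed
  have bdd: "- r0 - (norm (p - x0s))\<^sup>2 / 2 \<le> F x" if x: "x \<in> S" for x
  proof -
    have "(p - x0s) x \<le> norm (p - x0s) * norm x"
      using norm_blinfun[of "p - x0s" x] by simp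
    also have "\<dots> \<le> (norm (p - x0s))\<^sup>2 / 2 + (norm x)\<^sup>2 / 2"
      using sum_squares_bound[of "norm (p - x0s)" "norm x"] by simp
    finally show ?thesis using f_ge[OF x] by (simp add: F_def q_def blinfun.diff_left)
  qed
  obtain s where s: "s \<in> S" and min: "\<And>x. x \<in> S \<Longrightarrow> F s \<le> F x + e * dist x s"
    using ekeland_variational_principle[OF closed _ bdd e] uS by blast
  define n where "n x = e * norm (x - s)" for x
  have nconv: "convex_on UNIV n"
  proof (rule convex_onI)
    fix t x y assume t: "(0::real) < t" "t < 1"
    have "((1 - t) *\<^sub>R x + t *\<^sub>R y) - s = (1 - t) *\<^sub>R (x - s) + t *\<^sub>R (y - s)"
      by (simp add: algebra_simps)
    then have "norm (((1 - t) *\<^sub>R x + t *\<^sub>R y) - s) \<le> (1 - t) * norm (x - s) + t * norm (y - s)"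
      using norm_triangle_ineq[of "(1 - t) *\<^sub>R (x - s)" "t *\<^sub>R (y - s)"] t by simp
    then have "n ((1 - t) *\<^sub>R x + t *\<^sub>R y) \<le> e * ((1 - t) * norm (x - s) + t * norm (y - s))"
      unfolding n_def using e by (intro mult_left_mono) auto
    then show "n ((1 - t) *\<^sub>R x + t *\<^sub>R y) \<le> (1 - t) * n x + t * n y"
      by (simp add: n_def algebra_simps)
  qed simp
  obtain l where l: "\<And>x. x \<in> S \<Longrightarrow> f s + blinfun_apply l (x - s) \<le> f x"
    "\<And>y. (q s + (n s + (- p) s)) - l (y - s) \<le> q y + (n y + (- p) y)"
  proof (rule subgradient_split[OF fconv _ _ s])
    show "convex_on UNIV (\<lambda>x. q x + (n x + (- p) x))"
      by (intro convex_on_add qconv nconv blin)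
    show "isCont (\<lambda>x. q x + (n x + (- p) x)) s"
      unfolding q_def n_def by (intro continuous_intros) auto
    show "f s + (q s + (n s + (- p) s)) \<le> f x + (q x + (n x + (- p) x))" if "x \<in> S" for x
      using min[OF that] by (simp add: F_def n_def dist_norm blinfun.minus_left)
  qed blast
  \<comment> \<open>By the first split, \<open>s\<close> also minimises
    \<open>q + n + (l - p)\<close>. Splitting off \<open>q\<close> leaves an inequality that bounds
    \<open>l + z - p\<close> by the slope \<open>e\<close> of \<open>n\<close>.\<close>
  obtain z where z: "\<And>x. x \<in> UNIV \<Longrightarrow> q s + blinfun_apply z (x - s) \<le> q x"
    "\<And>y. (n s + (l - p) s) - z (y - s) \<le> n y + (l - p) y"
  proof (rule subgradient_split[OF qconv])
    show "convex_on UNIV (\<lambda>x. n x + (l - p) x)"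
      by (intro convex_on_add nconv blin)
    show "isCont (\<lambda>x. n x + (l - p) x) s"
      unfolding n_def by (intro continuous_intros)
    show "q s + (n s + (l - p) s) \<le> q x + (n x + (l - p) x)" for x
      using l(2)[of x] by (simp add: blinfun.diff_left blinfun.diff_right blinfun.minus_left)
  qed auto
  show thesis
  proof (rule that)
    show "s \<in> subdiff_X g l"
    proof (rule conj_X_subgradient_imp_subdiff_X[OF conv lsc _ minorant f[OF s]])
      show "edom g \<noteq> {}" using finite by (force simp: edom_def)
      show "ereal (f s + l (x - s)) \<le> conj_X g x" for x
        using l(1)[of x] f[of x] by (cases "x \<in> S") (auto simp: S_def edom_def)
    qed
    show "(norm s)\<^sup>2 / 2 + z (y - s) \<le> (norm y)\<^sup>2 / 2" for y
      using z(1)[of y] by (simp add: q_def)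
    have "\<bar>(l + z - p) d\<bar> \<le> e * norm d" for d
      using z(2)[of "s + d"] z(2)[of "s - d"]
      by (simp add: n_def blinfun.add_left blinfun.diff_left blinfun.add_right blinfun.diff_right blinfun.minus_right)
    then show "norm (l + z - p) \<le> e"
      using e by (intro norm_blinfun_bound) auto
  qed
qed

section \<open>Integration of shared subgradients\<close>

text \<open>Along a partition of a segment into \<open>n + 1\<close> equal steps the increments of \<open>G - H\<close> are
  bounded by differences of successive subgradients applied to an (almost) constant vector, so
  the sum telescopes to \<open>O(1 / (n + 1))\<close>.\<close>

lemma shared_subgradients_imp_diff_le:
  fixes G H :: "'b::real_normed_vector \<Rightarrow> real"
  assumes contG: "continuous_on UNIV G" and contH: "continuous_on UNIV H"
    and bounded: "\<And>R. \<exists>B. \<forall>p. norm p \<le> R \<longrightarrow> \<bar>G p\<bar> \<le> B"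
    and dense: "\<And>p e. 0 < e \<Longrightarrow> \<exists>p' l. norm (p' - p) \<le> e \<and> linear l \<and>
      (\<forall>y. G p' + l (y - p') \<le> G y) \<and> (\<forall>y. H p' + l (y - p') \<le> H y)"
  shows "G b - H b \<le> G a - H a"
proof -
  \<comment> \<open>The points \<open>P n i\<close> stay within 1 of the segment, and unit test
    vectors are added to them; together this gives the 2.\<close>
  define R where "R = norm a + norm b + 2"
  obtain B where B: "\<And>p. norm p \<le> R \<Longrightarrow> \<bar>G p\<bar> \<le> B" using bounded[of R] by blast
  define K where "K = 2 * B"
  define D where "D = norm (b - a)"
  define e where "e n = inverse (real (Suc n))" for n
  define \<pi> where "\<pi> n i = a + (real i * e n) *\<^sub>R (b - a)" for n i
  have e: "0 < e n" "e n \<le> 1" "real (Suc n) * e n = 1" for n by (auto simp: e_def field_simps)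
  \<comment> \<open>The squared tolerance makes the \<open>n + 1\<close> errors add up to a multiple
    of \<open>e n\<close>.\<close>
  have "\<exists>p' l. norm (p' - \<pi> n i) \<le> (e n)\<^sup>2 \<and> linear l \<and>
      (\<forall>y. G p' + l (y - p') \<le> G y) \<and> (\<forall>y. H p' + l (y - p') \<le> H y)" for n i
    using dense[of "(e n)\<^sup>2" "\<pi> n i"] e(1)[of n] by simp
  then obtain P l where P: "\<And>n i. norm (P n i - \<pi> n i) \<le> (e n)\<^sup>2"
    and l: "\<And>n i. linear (l n i)" and lG: "\<And>n i y. G (P n i) + l n i (y - P n i) \<le> G y"
    and lH: "\<And>n i y. H (P n i) + l n i (y - P n i) \<le> H y" by metis
  have e2: "(e n)\<^sup>2 \<le> 1" for n using e[of n] by (simp add: power_le_one)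
  have normP: "norm (P n i) \<le> norm a + norm b + 1" if i: "i \<le> Suc n" for n i
  proof -
    define t where "t = real i * e n"
    have "real i * e n \<le> real (Suc n) * e n" using i e(1)[of n] by (intro mult_right_mono) auto
    then have t: "0 \<le> t" "t \<le> 1" unfolding t_def e(3) using e(1)[of n] by auto
    have "\<pi> n i = (1 - t) *\<^sub>R a + t *\<^sub>R b" by (simp add: \<pi>_def t_def algebra_simps)
    then have "norm (\<pi> n i) \<le> (1 - t) * norm a + t * norm b"
      using t norm_triangle_ineq[of "(1 - t) *\<^sub>R a" "t *\<^sub>R b"] by simp
    also have "\<dots> \<le> norm a + norm b" using t by (intro add_mono mult_left_le_one_le) auto
    finally show ?thesis
      using P[of n i] e2[of n] norm_triangle_ineq[of "\<pi> n i" "P n i - \<pi> n i"] by simp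
  qed
  have bound: "\<bar>l n i w\<bar> \<le> K * norm w" if i: "i \<le> Suc n" for n i w
  proof (cases "w = 0")
    case True
    then show ?thesis using linear_0[OF l] by simp
  next
    case False
    have small: "l n i v \<le> K" if v: "norm v \<le> 1" for v
    proof -
      have "\<bar>G (P n i + v)\<bar> \<le> B" "\<bar>G (P n i)\<bar> \<le> B"
        using normP[OF i] norm_triangle_ineq[of "P n i" v] v by (auto simp: R_def intro!: B)
      then show ?thesis using lG[of n i "P n i + v"] by (simp add: K_def)
    qed
    have "l n i (w /\<^sub>R norm w) \<le> K" "l n i ((- w) /\<^sub>R norm w) \<le> K"
      using False by (auto intro!: small)
    then have "l n i w / norm w \<le> K" "- l n i w / norm w \<le> K"
      using l[of n i] by (simp_all only: linear_scale linear_neg) (simp_all add: field_simps)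
    then show ?thesis using False by (simp add: abs_le_iff field_simps)
  qed
  have K: "0 \<le> K" using B[of 0] by (simp add: K_def R_def)
  have step: "(G (P n (Suc i)) - H (P n (Suc i))) - (G (P n i) - H (P n i))
      \<le> (e n * l n (Suc i) (b - a) - e n * l n i (b - a)) + 4 * K * (e n)\<^sup>2" if i: "i < Suc n" for n i
  proof -
    define w where "w = P n (Suc i) - P n i - e n *\<^sub>R (b - a)"
    have "w = (P n (Suc i) - \<pi> n (Suc i)) - (P n i - \<pi> n i)"
      by (simp add: w_def \<pi>_def algebra_simps)
    then have w: "norm w \<le> 2 * (e n)\<^sup>2"
      using P[of n i] P[of n "Suc i"] norm_triangle_ineq4[of "P n (Suc i) - \<pi> n (Suc i)" "P n i - \<pi> n i"]
      by simp
    have lw: "\<bar>l n j w\<bar> \<le> 2 * K * (e n)\<^sup>2" if "j \<le> Suc n" for j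
      using bound[OF that, of w] mult_left_mono[OF w K] by simp
    have eqs: "l n j (P n (Suc i) - P n i) = e n * l n j (b - a) + l n j w" for j
    proof -
      have "P n (Suc i) - P n i = e n *\<^sub>R (b - a) + w" by (simp add: w_def)
      then show ?thesis using l[of n j] by (simp add: linear_add linear_scale)
    qed
    have "l n (Suc i) (P n i - P n (Suc i)) = - l n (Suc i) (P n (Suc i) - P n i)"
      using linear_neg[OF l, of n "Suc i" "P n (Suc i) - P n i"] by simp
    \<comment> \<open>The increment of \<open>G\<close> is bounded above with the subgradient at the
      right end, that of \<open>H\<close> below with the one at the left end; this difference is
      what telescopes.\<close>
    then have "G (P n (Suc i)) - G (P n i) \<le> l n (Suc i) (P n (Suc i) - P n i)"
      using lG[of n "Suc i" "P n i"] by simp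
    moreover have "l n i (P n (Suc i) - P n i) \<le> H (P n (Suc i)) - H (P n i)"
      using lH[of n i "P n (Suc i)"] by simp
    ultimately show ?thesis
      using lw[of i] lw[of "Suc i"] i unfolding eqs by simp
  qed
  have main: "(G (P n (Suc n)) - H (P n (Suc n))) - (G (P n 0) - H (P n 0)) \<le> e n * (2 * K * D + 4 * K)" for n
  proof -
    have "(\<Sum>i<Suc n. (G (P n (Suc i)) - H (P n (Suc i))) - (G (P n i) - H (P n i)))
        \<le> (\<Sum>i<Suc n. (e n * l n (Suc i) (b - a) - e n * l n i (b - a)) + 4 * K * (e n)\<^sup>2)"
      using step by (intro sum_mono) auto
    also have "\<dots> = (e n * l n (Suc n) (b - a) - e n * l n 0 (b - a)) + real (Suc n) * (4 * K * (e n)\<^sup>2)"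
      unfolding sum.distrib sum_lessThan_telescope[of "\<lambda>i. e n * l n i (b - a)"] by simp
    also have "real (Suc n) * (4 * K * (e n)\<^sup>2) = (real (Suc n) * e n) * (4 * K * e n)"
      by (simp only: power2_eq_square ac_simps)
    also have "\<dots> = e n * (4 * K)" unfolding e(3) by simp
    also have "e n * l n (Suc n) (b - a) - e n * l n 0 (b - a) \<le> e n * (2 * K * D)"
    proof -
      have "l n (Suc n) (b - a) - l n 0 (b - a) \<le> 2 * K * D"
        using bound[of "Suc n" n "b - a"] bound[of 0 n "b - a"] by (simp add: D_def)
      then show ?thesis using e(1)[of n] by (simp flip: right_diff_distrib)
    qed
    finally show ?thesis
      unfolding sum_lessThan_telescope[of "\<lambda>i. G (P n i) - H (P n i)"] by (simp add: algebra_simps)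
  qed
  have e_lim: "e \<longlonglongrightarrow> 0" unfolding e_def by (rule LIMSEQ_inverse_real_of_nat)
  have lim: "(\<lambda>n. P n (k n)) \<longlonglongrightarrow> c" if "\<And>n. \<pi> n (k n) = c" for k c
  proof -
    have "(\<lambda>n. P n (k n) - c) \<longlonglongrightarrow> 0"
    proof (rule Lim_null_comparison)
      show "\<forall>\<^sub>F n in sequentially. norm (P n (k n) - c) \<le> (e n)\<^sup>2"
        using P that by (metis (mono_tags, lifting) always_eventually)
      show "(\<lambda>n. (e n)\<^sup>2) \<longlonglongrightarrow> 0" using tendsto_power[OF e_lim, of 2] by simp
    qed
    then show ?thesis by (simp add: LIM_zero_iff)
  qed
  have la: "(\<lambda>n. P n 0) \<longlonglongrightarrow> a" by (rule lim) (simp add: \<pi>_def)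
  have lb: "(\<lambda>n. P n (Suc n)) \<longlonglongrightarrow> b" by (rule lim) (simp only: \<pi>_def e(3), simp)
  have GH: "isCont G x" "isCont H x" for x
    using contG contH by (simp_all add: continuous_on_eq_continuous_at)
  have "(\<lambda>n. (G (P n (Suc n)) - H (P n (Suc n))) - (G (P n 0) - H (P n 0)))
      \<longlonglongrightarrow> (G b - H b) - (G a - H a)"
    by (intro tendsto_diff isCont_tendsto_compose[OF GH(1)] isCont_tendsto_compose[OF GH(2)] la lb)
  moreover have "(\<lambda>n. e n * (2 * K * D + 4 * K)) \<longlonglongrightarrow> 0"
    using tendsto_mult_right[OF e_lim, of "2 * K * D + 4 * K"] by simp
  ultimately have "(G b - H b) - (G a - H a) \<le> 0"
    by (rule LIMSEQ_le) (use main in blast)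
  then show ?thesis by simp
qed

section \<open>Conjugates of functions regularised by half the squared norm\<close>

definition regularised_conj :: "'a set \<Rightarrow> ('a::real_normed_vector \<Rightarrow> real) \<Rightarrow> ('a \<Rightarrow>\<^sub>L real) \<Rightarrow> real" where
  "regularised_conj S f p = (SUP y\<in>S. p y - f y - (norm y)\<^sup>2 / 2)"

lemma regularised_conj_least:
  fixes p :: "'a::real_normed_vector \<Rightarrow>\<^sub>L real"
  assumes "S \<noteq> {}" "\<And>y. y \<in> S \<Longrightarrow> p y - f y - (norm y)\<^sup>2 / 2 \<le> c"
  shows "regularised_conj S f p \<le> c"
  unfolding regularised_conj_def using assms by (intro cSUP_least) auto

text \<open>The quadratic term absorbs all linear growth. This makes the real supremum in
  \<open>regularised_conj\<close> meaningful whenever \<open>f\<close> has a continuous affine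
  minorant.\<close>

lemma affine_minorant_imp_quadratic_bound:
  fixes u p :: "'a::real_normed_vector \<Rightarrow>\<^sub>L real"
  assumes "blinfun_apply u y - b \<le> f y"
  shows "p y - f y - (norm y)\<^sup>2 / 2 \<le> (norm (p - u))\<^sup>2 / 2 + b"
proof -
  have "(p - u) y \<le> norm (p - u) * norm y"
    using norm_blinfun[of "p - u" y] by simp
  also have "\<dots> \<le> (norm (p - u))\<^sup>2 / 2 + (norm y)\<^sup>2 / 2"
    using sum_squares_bound[of "norm (p - u)" "norm y"] by simp
  finally show ?thesis using assms by (simp add: blinfun.diff_left)
qed

lemma regularised_conj_upper:
  fixes u p :: "'a::real_normed_vector \<Rightarrow>\<^sub>L real"
  assumes "\<And>y. y \<in> S \<Longrightarrow> blinfun_apply u y - b \<le> f y" "y \<in> S"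
  shows "p y - f y - (norm y)\<^sup>2 / 2 \<le> regularised_conj S f p"
  unfolding regularised_conj_def
proof (rule cSUP_upper[OF assms(2)])
  show "bdd_above ((\<lambda>y. p y - f y - (norm y)\<^sup>2 / 2) ` S)"
    by (rule bdd_aboveI2) (rule affine_minorant_imp_quadratic_bound[OF assms(1)])
qed

lemma regularised_conj_bounded:
  fixes u :: "'a::real_normed_vector \<Rightarrow>\<^sub>L real"
  assumes minorant: "\<And>y. y \<in> S \<Longrightarrow> blinfun_apply u y - b \<le> f y" and x: "x \<in> S"
  shows "\<exists>B. \<forall>p. norm p \<le> R \<longrightarrow> \<bar>regularised_conj S f p\<bar> \<le> B"
proof (intro exI allI impI)
  fix p :: "'a \<Rightarrow>\<^sub>L real" assume p: "norm p \<le> R"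
  have "regularised_conj S f p \<le> (norm (p - u))\<^sup>2 / 2 + b"
    using x by (intro regularised_conj_least affine_minorant_imp_quadratic_bound minorant) auto
  moreover have "(norm (p - u))\<^sup>2 \<le> (R + norm u)\<^sup>2"
    using p norm_triangle_ineq4[of p u] by (intro power_mono) auto
  moreover have "- (R * norm x) \<le> p x"
    using norm_blinfun[of p x] p mult_right_mono[OF p, of "norm x"] by simp
  moreover have "p x - f x - (norm x)\<^sup>2 / 2 \<le> regularised_conj S f p"
    by (rule regularised_conj_upper[OF minorant x])
  ultimately show "\<bar>regularised_conj S f p\<bar>
      \<le> ((R + norm u)\<^sup>2 / 2 + \<bar>b\<bar>) + \<bar>R * norm x + f x + (norm x)\<^sup>2 / 2\<bar>"
    using zero_le_power2[of "R + norm u"] by linarith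
qed

text \<open>A finite convex function that is bounded on balls is continuous.\<close>

lemma regularised_conj_continuous:
  fixes u :: "'a::real_normed_vector \<Rightarrow>\<^sub>L real"
  assumes minorant: "\<And>y. y \<in> S \<Longrightarrow> blinfun_apply u y - b \<le> f y" and x: "x \<in> S"
  shows "continuous_on UNIV (regularised_conj S f)"
proof -
  have conv: "convex_on UNIV (regularised_conj S f)"
  proof (rule convex_onI)
    fix t and p r :: "'a \<Rightarrow>\<^sub>L real" assume t: "(0::real) < t" "t < 1"
    show "regularised_conj S f ((1 - t) *\<^sub>R p + t *\<^sub>R r)
        \<le> (1 - t) * regularised_conj S f p + t * regularised_conj S f r"
    proof (rule regularised_conj_least)
      fix y assume y: "y \<in> S"
      have "((1 - t) *\<^sub>R p + t *\<^sub>R r) y - f y - (norm y)\<^sup>2 / 2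
          = (1 - t) * (p y - f y - (norm y)\<^sup>2 / 2) + t * (r y - f y - (norm y)\<^sup>2 / 2)"
        by (simp add: blinfun.add_left blinfun.diff_left blinfun.scaleR_left algebra_simps add_divide_distrib diff_divide_distrib)
      also have "\<dots> \<le> (1 - t) * regularised_conj S f p + t * regularised_conj S f r"
        using t by (intro add_mono mult_left_mono regularised_conj_upper[OF minorant y]) auto
      finally show "((1 - t) *\<^sub>R p + t *\<^sub>R r) y - f y - (norm y)\<^sup>2 / 2
          \<le> (1 - t) * regularised_conj S f p + t * regularised_conj S f r" .
    qed (use x in blast)
  qed simp
  have "isCont (regularised_conj S f) p" for p
  proof -
    obtain B where B: "\<And>r. norm r \<le> norm p + 1 \<Longrightarrow> \<bar>regularised_conj S f r\<bar> \<le> B"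
      using regularised_conj_bounded[OF minorant x] by blast
    have "norm r \<le> norm p + 1" if "r \<in> ball p 1" for r
      using that norm_triangle_sub[of r p] by (simp add: dist_norm norm_minus_commute)
    then have "continuous_on (ball p 1) (regularised_conj S f)"
      by (intro convex_on_bounded_continuous[of _ _ B] convex_on_subset[OF conv]) (auto intro: B)
    then show ?thesis by (simp add: continuous_on_eq_continuous_at)
  qed
  then show ?thesis by (simp add: continuous_on_eq_continuous_at)
qed

text \<open>By addition, \<open>l + z\<close> is a subgradient of the regularised function at
  \<open>s\<close>, so the supremum defining the conjugate at \<open>l + z\<close> is attained at
  \<open>s\<close>.\<close>

lemma regularised_conj_subgradient:
  fixes u p :: "'a::real_normed_vector \<Rightarrow>\<^sub>L real"
  assumes minorant: "\<And>y. y \<in> S \<Longrightarrow> blinfun_apply u y - b \<le> f y" and s: "s \<in> S"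
    and l: "\<And>y. y \<in> S \<Longrightarrow> f s + blinfun_apply l (y - s) \<le> f y"
    and z: "\<And>y. (norm s)\<^sup>2 / 2 + blinfun_apply z (y - s) \<le> (norm y)\<^sup>2 / 2"
  shows "regularised_conj S f (l + z) + blinfun_apply (p - (l + z)) s \<le> regularised_conj S f p"
proof -
  have "regularised_conj S f (l + z) \<le> (l + z) s - f s - (norm s)\<^sup>2 / 2"
  proof (rule regularised_conj_least)
    fix y assume "y \<in> S"
    then show "(l + z) y - f y - (norm y)\<^sup>2 / 2 \<le> (l + z) s - f s - (norm s)\<^sup>2 / 2"
      using l[of y] z[of y] by (simp add: blinfun.add_left blinfun.diff_right)
  qed (use s in blast)
  then show ?thesis
    using regularised_conj_upper[OF minorant s, of p] by (simp add: blinfun.diff_left)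
qed

text \<open>\<open>conj_X h + (norm _)\<^sup>2 / 2\<close> is recovered from its own conjugate without a separation
  theorem, because it is already a supremum of continuous affine functions.\<close>

lemma conj_X_le_of_regularised_conj:
  fixes h :: "('a::real_normed_vector \<Rightarrow>\<^sub>L real) \<Rightarrow> ereal"
  assumes ne: "edom (conj_X h) \<noteq> {}" and ninf: "\<And>y. conj_X h y \<noteq> - \<infinity>"
    and C: "\<And>p. blinfun_apply p x - regularised_conj (edom (conj_X h)) (\<lambda>y. real_of_ereal (conj_X h y)) p \<le> C"
  shows "conj_X h x \<le> ereal (C - (norm x)\<^sup>2 / 2)"
proof (rule conj_X_least)
  fix xs :: "'a \<Rightarrow>\<^sub>L real"
  obtain z where z: "\<And>y. (norm x)\<^sup>2 / 2 + blinfun_apply z (y - x) \<le> (norm y)\<^sup>2 / 2"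
    using half_norm_square_subgradient[of x] by blast
  show "ereal (xs x - (C - (norm x)\<^sup>2 / 2)) \<le> h xs"
  proof (cases "h xs")
    case (real r)
    \<comment> \<open>The dual point \<open>xs + z\<close> is chosen so that \<open>xs\<close>
      bounds the conjugate from below and \<open>z\<close> bounds the quadratic, with equality for
      the latter at \<open>x\<close>.\<close>
    have "regularised_conj (edom (conj_X h)) (\<lambda>y. real_of_ereal (conj_X h y)) (xs + z)
        \<le> z x - (norm x)\<^sup>2 / 2 + r"
    proof (rule regularised_conj_least[OF ne])
      fix y assume y: "y \<in> edom (conj_X h)"
      have "xs y - r \<le> real_of_ereal (conj_X h y)"
        using conj_X_upper[of xs y h] ereal_real_edom[of "conj_X h", OF ninf y] real
        by (metis ereal_less_eq(3) ereal_minus(1))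
      then show "(xs + z) y - real_of_ereal (conj_X h y) - (norm y)\<^sup>2 / 2 \<le> z x - (norm x)\<^sup>2 / 2 + r"
        using z[of y] by (simp add: blinfun.add_left blinfun.diff_right)
    qed
    then show ?thesis using C[of "xs + z"] real by (simp add: blinfun.add_left)
  next
    case MInf
    obtain y where "y \<in> edom (conj_X h)" using ne by blast
    then show ?thesis using conj_X_upper[of xs y h] MInf by (auto simp: edom_def)
  qed simp
qed

lemma subdiff_X_finite:
  assumes "s \<in> subdiff_X g l" "\<And>y. g y \<noteq> - \<infinity>"
  obtains r where "g l = ereal r" "\<And>y. ereal (r + blinfun_apply (y - l) s) \<le> g y"
proof -
  obtain r where r: "g l = ereal r"
    using assms(1) assms(2)[of l] by (cases "g l") (auto simp: subdiff_X_def)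
  have "ereal (r + blinfun_apply (y - l) s) \<le> g y" for y
  proof -
    have "ereal (blinfun_apply (y - l) s) \<le> g y - g l"
      using assms(1) by (simp add: subdiff_X_def)
    then show ?thesis using r by (cases "g y") auto
  qed
  then show thesis using that r by blast
qed

text \<open>The hypotheses on \<open>h\<close> record what the chain supremum satisfies by
  construction; \<open>sub\<close> is the effect of lengthening a chain by one link.\<close>

lemma determined_by_subdiff_X:
  fixes g h :: "('a::banach \<Rightarrow>\<^sub>L real) \<Rightarrow> ereal"
  assumes conv: "econvex g" and lsc: "weak_star_lsc g" and ninf: "\<And>y. g y \<noteq> - \<infinity>"
    and x0: "x0 \<in> subdiff_X g x0s" and hg: "\<And>y. h y \<le> g y" and h0: "h x0s = g x0s"
    and sub: "\<And>s l y. s \<in> subdiff_X g l \<Longrightarrow> h l + ereal (blinfun_apply (y - l) s) \<le> h y"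
  shows "h = g"
proof -
  obtain r0 where r0: "g x0s = ereal r0"
    and minorant: "\<And>y. ereal (r0 + blinfun_apply (y - x0s) x0) \<le> g y"
    using subdiff_X_finite[OF x0 ninf] by blast
  have minorant': "ereal (blinfun_apply y x0 - (x0s x0 - r0)) \<le> g y" for y
    using minorant[of y] by (simp add: blinfun.diff_left algebra_simps)
  have hninf: "h y \<noteq> - \<infinity>" for y
    using sub[OF x0, of y] by (auto simp: h0 r0)
  define f k where "f = conj_X g" and "k = conj_X h"
  have fk: "f y \<le> k y" for y unfolding f_def k_def by (rule conj_X_antimono[OF hg])
  have f_ge: "ereal (x0s y - r0) \<le> f y" for y
    using conj_X_upper[of x0s y g] by (simp add: f_def r0)
  have fninf: "f y \<noteq> - \<infinity>" and kninf: "k y \<noteq> - \<infinity>" for y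
    using f_ge[of y] fk[of y] by auto
  define S T where "S = edom f" and "T = edom k"
  have TS: "T \<subseteq> S" unfolding S_def T_def edom_def using le_less_trans[OF fk] by blast
  define fr kr where "fr y = real_of_ereal (f y)" and "kr y = real_of_ereal (k y)" for y
  have fr: "f y = ereal (fr y)" if "y \<in> S" for y
    unfolding fr_def using ereal_real_edom[of f, OF fninf] that by (simp add: S_def)
  have kr: "k y = ereal (kr y)" if "y \<in> T" for y
    unfolding kr_def using ereal_real_edom[of k, OF kninf] that by (simp add: T_def)
  have fr_ge: "x0s y - r0 \<le> fr y" if "y \<in> S" for y using f_ge[of y] fr[OF that] by simp
  have kr_ge: "x0s y - r0 \<le> kr y" if "y \<in> T" for y
    using fr_ge[of y] fk[of y] fr[of y] kr[OF that] TS that by auto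
  define G H where "G = regularised_conj S fr" and "H = regularised_conj T kr"
  have shared: "s \<in> S \<and> s \<in> T \<and> (\<forall>y\<in>S. fr s + l (y - s) \<le> fr y) \<and> (\<forall>y\<in>T. kr s + l (y - s) \<le> kr y)"
    if s: "s \<in> subdiff_X g l" for s l
  proof -
    obtain r where r: "g l = ereal r" "\<And>y. ereal (r + blinfun_apply (y - l) s) \<le> g y"
      using subdiff_X_finite[OF s ninf] by blast
    obtain r' where r': "h l = ereal r'"
      using hg[of l] hninf[of l] r(1) by (cases "h l") auto
    have fs: "f s = ereal (l s - r)"
      unfolding f_def by (rule conj_X_eq[of g l r, OF r(1)]) (use r in simp)
    have ks: "k s = ereal (l s - r')"
      unfolding k_def by (rule conj_X_eq[of h l r', OF r' sub[OF s]])
    have sST: "s \<in> S" "s \<in> T" by (simp_all add: S_def T_def edom_def fs ks)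
    have "fr s + l (y - s) \<le> fr y" if "y \<in> S" for y
      using conj_X_upper[of l y g, folded f_def] fr[OF that] fs fr[OF sST(1)] r(1)
      by (simp add: blinfun.diff_right)
    moreover have "kr s + l (y - s) \<le> kr y" if "y \<in> T" for y
      using conj_X_upper[of l y h, folded k_def] kr[OF that] ks kr[OF sST(2)] r'
      by (simp add: blinfun.diff_right)
    ultimately show ?thesis using sST by blast
  qed
  have x0S: "x0 \<in> S" and x0T: "x0 \<in> T" using shared[OF x0] by auto
  have x0_eq: "fr x0 = kr x0"
  proof -
    have "f x0 = ereal (x0s x0 - r0)"
      unfolding f_def by (rule conj_X_eq[of g x0s r0, OF r0]) (use minorant r0 in simp)
    moreover have "k x0 = ereal (x0s x0 - r0)"
      unfolding k_def by (rule conj_X_eq[of h x0s r0, OF _ sub[OF x0]]) (simp add: h0 r0)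
    ultimately show ?thesis by (simp add: fr_def kr_def)
  qed
  have dense: "\<exists>p' l. norm (p' - p) \<le> e \<and> linear l \<and>
      (\<forall>y. G p' + l (y - p') \<le> G y) \<and> (\<forall>y. H p' + l (y - p') \<le> H y)" if e: "0 < e" for p e
  proof -
    obtain s l z where s: "s \<in> subdiff_X g l"
      and z: "\<And>y. (norm s)\<^sup>2 / 2 + blinfun_apply z (y - s) \<le> (norm y)\<^sup>2 / 2"
      and close: "norm (l + z - p) \<le> e"
      using dense_regularised_subgradients[OF conv lsc ninf r0 minorant' e] by blast
    have "linear (\<lambda>y :: 'a \<Rightarrow>\<^sub>L real. y s)"
      by (rule linearI) (simp_all add: blinfun.add_left blinfun.scaleR_left)
    moreover have "G (l + z) + (p' - (l + z)) s \<le> G p'" for p'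
      unfolding G_def
      by (rule regularised_conj_subgradient[OF fr_ge]) (use shared[OF s] z in auto)
    moreover have "H (l + z) + (p' - (l + z)) s \<le> H p'" for p'
      unfolding H_def
      by (rule regularised_conj_subgradient[OF kr_ge]) (use shared[OF s] z in auto)
    ultimately show ?thesis using close by blast
  qed
  have contG: "continuous_on UNIV G"
    unfolding G_def by (rule regularised_conj_continuous[OF fr_ge x0S])
  have contH: "continuous_on UNIV H"
    unfolding H_def by (rule regularised_conj_continuous[OF kr_ge x0T])
  have "G b - H b \<le> G a - H a" for a b
    by (rule shared_subgradients_imp_diff_le[OF contG contH _ dense])
      (auto simp: G_def intro: regularised_conj_bounded[OF fr_ge x0S])
  then have "G p - H p = G 0 - H 0" for p by (metis antisym)
  then obtain c where c: "\<And>p. G p = H p + c" by (metis diff_add_cancel add.commute)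
  have f_le: "f x \<le> ereal (C - (norm x)\<^sup>2 / 2)" if "\<And>p. blinfun_apply p x - G p \<le> C" for x C
    unfolding f_def by (rule conj_X_le_of_regularised_conj)
      (use that x0S fninf in \<open>auto simp: G_def S_def fr_def[abs_def] f_def\<close>)
  have k_le: "k x \<le> ereal (C - (norm x)\<^sup>2 / 2)" if "\<And>p. blinfun_apply p x - H p \<le> C" for x C
    unfolding k_def by (rule conj_X_le_of_regularised_conj)
      (use that x0T kninf in \<open>auto simp: H_def T_def kr_def[abs_def] k_def\<close>)
  \<comment> \<open>Recovering \<open>f x0\<close> from \<open>G = H + c\<close> gives at most
    \<open>kr x0 - c\<close>. Since this must reach \<open>fr x0 = kr x0\<close>, the constant
    cannot be positive.\<close>
  have "blinfun_apply p x0 - G p \<le> kr x0 + (norm x0)\<^sup>2 / 2 - c" for p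
    using regularised_conj_upper[OF kr_ge x0T, of p] by (simp add: c H_def)
  from f_le[OF this] have "c \<le> 0" using fr[OF x0S] x0_eq by simp
  have kf: "k y \<le> f y" for y
  proof (cases "y \<in> S")
    case True
    have "blinfun_apply p y - H p \<le> fr y + (norm y)\<^sup>2 / 2" for p
      using regularised_conj_upper[OF fr_ge True, of p] \<open>c \<le> 0\<close> c[of p] by (simp add: G_def)
    from k_le[OF this] show ?thesis using fr[OF True] by simp
  qed (simp add: S_def edom_def)
  have "g xs \<le> h xs" for xs
  proof (rule ccontr)
    assume "\<not> g xs \<le> h xs"
    then obtain r where r: "h xs < ereal r" "ereal r < g xs"
      by (metis ereal_dense2 not_le)
    have "edom g \<noteq> {}" using r0 by (force simp: edom_def)
    \<comment> \<open>This minorant exceeds \<open>h\<close> at \<open>xs\<close>, so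
      \<open>f v \<le> xs v - r < xs v - h xs \<le> k v\<close>, against
      \<open>k \<le> f\<close>.\<close>
    then obtain v where v: "\<And>y. ereal (r + blinfun_apply (y - xs) v) \<le> g y"
      using weak_star_affine_minorant[OF conv lsc _ minorant' r(2)] by blast
    then have "f v \<le> ereal (xs v - r)"
      unfolding f_def by (intro conj_X_least) (simp add: blinfun.diff_left algebra_simps)
    then have "ereal (xs v) - h xs \<le> ereal (xs v - r)"
      using kf[of v] conj_X_upper[of xs v h, folded k_def] by (meson order_trans)
    then show False using r(1) hninf[of xs] by (cases "h xs") auto
  qed
  then show "h = g" using hg by (intro ext antisym) auto
qed

section \<open>Chain sums\<close>

text \<open>The chain with \<open>n = 0\<close>. It keeps the set of sums nonempty, so that the
  supremum is not minus infinity.\<close>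

lemma chain_sums_single:
  assumes "x0 \<in> subdiff_X g x0s"
  shows "blinfun_apply (y - x0s) x0 \<in> chain_sums g x0s y"
  unfolding chain_sums_def
  using assms by (intro CollectI exI[of _ 0] exI[of _ "\<lambda>_. x0s"] exI[of _ "\<lambda>_. x0"]) simp

text \<open>The old end point \<open>l\<close> becomes the point with index \<open>n + 1\<close>,
  which turns the old final term into an ordinary summand.\<close>

lemma chain_sums_extend:
  assumes c: "c \<in> chain_sums g x0s l" and s: "s \<in> subdiff_X g l"
  shows "c + blinfun_apply (y - l) s \<in> chain_sums g x0s y"
proof -
  obtain n ys xv where n: "c = (\<Sum>i<n. blinfun_apply (ys (Suc i) - ys i) (xv i)) + blinfun_apply (l - ys n) (xv n)"
    "ys 0 = x0s" "\<And>i. i \<le> n \<Longrightarrow> xv i \<in> subdiff_X g (ys i)"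
    using c unfolding chain_sums_def by blast
  let ?ys = "ys(Suc n := l)" and ?xv = "xv(Suc n := s)"
  have "(\<Sum>i<n. blinfun_apply (?ys (Suc i) - ?ys i) (?xv i)) = (\<Sum>i<n. blinfun_apply (ys (Suc i) - ys i) (xv i))"
    by (intro sum.cong) auto
  then have "c + blinfun_apply (y - l) s = (\<Sum>i<Suc n. blinfun_apply (?ys (Suc i) - ?ys i) (?xv i))
      + blinfun_apply (y - ?ys (Suc n)) (?xv (Suc n))"
    by (simp add: n(1))
  moreover have "?ys 0 = x0s" "\<forall>i\<le>Suc n. ?xv i \<in> subdiff_X g (?ys i)"
    using n s by (auto simp: le_Suc_eq)
  ultimately show ?thesis unfolding chain_sums_def by blast
qed

text \<open>The subgradient inequalities at the successive points add up along the chain.\<close>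

lemma chain_sums_le:
  assumes c: "c \<in> chain_sums g x0s y" and ninf: "\<And>y. g y \<noteq> - \<infinity>"
  shows "g x0s + ereal c \<le> g y"
proof -
  obtain n ys xv where n: "c = (\<Sum>i<n. blinfun_apply (ys (Suc i) - ys i) (xv i)) + blinfun_apply (y - ys n) (xv n)"
    "ys 0 = x0s" "\<And>i. i \<le> n \<Longrightarrow> xv i \<in> subdiff_X g (ys i)"
    using c unfolding chain_sums_def by blast
  have sub: "g (ys i) + ereal (blinfun_apply (z - ys i) (xv i)) \<le> g z" if "i \<le> n" for i z
    using subdiff_X_finite[OF n(3)[OF that] ninf] by (metis plus_ereal.simps(1))
  have "g x0s + ereal (\<Sum>i<j. blinfun_apply (ys (Suc i) - ys i) (xv i)) \<le> g (ys j)" if "j \<le> n" for j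
    using that
  proof (induction j)
    case (Suc j)
    then have "g x0s + ereal (\<Sum>i<j. blinfun_apply (ys (Suc i) - ys i) (xv i)) \<le> g (ys j)"
      and "j \<le> n" by simp_all
    then have "g x0s + ereal (\<Sum>i<j. blinfun_apply (ys (Suc i) - ys i) (xv i))
        + ereal (blinfun_apply (ys (Suc j) - ys j) (xv j)) \<le> g (ys (Suc j))"
      by (rule order_trans[OF add_right_mono sub])
    then show ?case by (simp add: add.assoc)
  qed (simp add: n(2) flip: zero_ereal_def)
  then have "g x0s + ereal (\<Sum>i<n. blinfun_apply (ys (Suc i) - ys i) (xv i))
      + ereal (blinfun_apply (y - ys n) (xv n)) \<le> g y"
    by (rule order_trans[OF add_right_mono sub]) simp_all
  then show ?thesis by (simp add: n(1) add.assoc)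
qed

lemma rockafellar_chain_formula:
  fixes g :: "('a::banach \<Rightarrow>\<^sub>L real) \<Rightarrow> ereal"
  assumes "proper_fun g" and conv: "econvex g" and lsc: "weak_star_lsc g"
    and "x0s \<in> dom_subdiff_X g"
  shows "g y = g x0s + (SUP s\<in>chain_sums g x0s y. ereal s)"
proof -
  have ninf: "g y \<noteq> - \<infinity>" for y using assms(1) by (simp add: proper_fun_def)
  obtain x0 where x0: "x0 \<in> subdiff_X g x0s" using assms(4) by (auto simp: dom_subdiff_X_def)
  obtain r0 where r0: "g x0s = ereal r0" using subdiff_X_finite[OF x0 ninf] by blast
  have h: "g x0s + (SUP s\<in>chain_sums g x0s y. ereal s) = (SUP s\<in>chain_sums g x0s y. g x0s + ereal s)" for y
    using chain_sums_single[OF x0, of y] by (subst SUP_ereal_add_right) (auto simp: r0)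
  \<comment> \<open>With \<open>g x0s\<close> inside the supremum, each property of \<open>h\<close>
    reduces to a statement about single chains; finiteness of \<open>g x0s\<close> permits the
    move.\<close>
  define h where "h y = (SUP s\<in>chain_sums g x0s y. g x0s + ereal s)" for y
  have hg: "h y \<le> g y" for y
    unfolding h_def by (intro SUP_least chain_sums_le ninf)
  have "h = g"
  proof (rule determined_by_subdiff_X[OF conv lsc ninf x0 hg])
    have "g x0s + ereal (blinfun_apply (x0s - x0s) x0) \<le> h x0s"
      unfolding h_def by (rule SUP_upper[OF chain_sums_single[OF x0]])
    then show "h x0s = g x0s" using hg[of x0s] by (simp flip: zero_ereal_def)
    fix s l y assume s: "s \<in> subdiff_X g l"
    have "h l + ereal (blinfun_apply (y - l) s)
        = (SUP c\<in>chain_sums g x0s l. (g x0s + ereal c) + ereal (blinfun_apply (y - l) s))"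
      unfolding h_def using chain_sums_single[OF x0, of l] by (subst SUP_ereal_add_left) auto
    also have "\<dots> \<le> h y"
    proof (rule SUP_least)
      fix c assume "c \<in> chain_sums g x0s l"
      then have "g x0s + ereal (c + blinfun_apply (y - l) s) \<le> h y"
        unfolding h_def by (intro SUP_upper chain_sums_extend s)
      then show "(g x0s + ereal c) + ereal (blinfun_apply (y - l) s) \<le> h y"
        by (simp add: add.assoc)
    qed
    finally show "h l + ereal (blinfun_apply (y - l) s) \<le> h y" .
  qed
  then show ?thesis unfolding h by (metis h_def)
qed

theorem mainTheorem12:
  fixes g :: "('a::banach \<Rightarrow>\<^sub>L real) \<Rightarrow> ereal"
  assumes "proper_fun g" and "econvex g" and "weak_star_lsc g"
  shows "(interior (edom g) \<noteq> {} \<longrightarrow>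
            (\<forall>x0s \<in> dom_subdiff_X g. \<forall>x_s \<in> edom g.
               g x_s = g x0s + (SUP s \<in> chain_sums g x0s x_s. ereal s)))
       \<and> (interior (edom (conj_X g)) \<noteq> {} \<longrightarrow>
            (\<forall>x0s \<in> dom_subdiff_X g. \<forall>x_s.
               g x_s = g x0s + (SUP s \<in> chain_sums g x0s x_s. ereal s)))"
  using rockafellar_chain_formula[OF assms] by blast

end
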